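(* Let $\mathfrak{g}$ be a finite dimensional reductive Lie algebra over $\mathbb{C}$. (1) The subalgebra $[U(\mathfrak{g}[t])]^{\mathfrak{g}}$ is spanned over $\mathbb{C}$ by the elements $\theta(n_1,\dots,n_k)$, where $\theta$ runs over a homogeneous basis of $[T(\mathfrak{g})]^{\mathfrak{g}}$ and, for $k=\deg\theta$, $n_1\le\cdots\le n_k$ runs over non-negative integers. (2) The subalgebra $[U(\mathfrak{g}[t])]^{\mathfrak{g}}$ is generated as an algebra by the elements $\theta(n_1,\dots,n_k)$, where $\theta$ runs over a set of homogeneous algebra generators of $[T(\mathfrak{g})]^{\mathfrak{g}}$ and, for $k=\deg\theta$, $n_1\le\cdots\le n_k$ runs over non-negative integers.
   Context: $\mathfrak{g}[t]=\mathfrak{g}\otimes\mathbb{C}[t]$ is the Lie algebra with bracket $[x(P),y(Q)]=[x,y](PQ)$, where $x(P):=x\otimes P$; $\mathfrak{g}$ is identified with $\mathfrak{g}\otimes 1$. $U(\mathfrak{g}[t])$ is its universal enveloping algebra and $[U(\mathfrak{g}[t])]^{\mathfrak{g}}$ the subalgebra of $\mathfrak{g}$-invariants under the adjoint action. $T(\mathfrak{g})=\bigoplus_{k\ge0}\mathfrak{g}^{\otimes k}$ is the tensor algebra, graded by $k$, with $\mathfrak{g}$ acting by the adjoint action on each factor; $[T(\mathfrak{g})]^{\mathfrak{g}}=\bigoplus_k[\mathfrak{g}^{\otimes k}]^{\mathfrak{g}}$ is its (graded) subalgebra of invariants. For $\theta=\sum_i x_1^i\otimes\cdots\otimes x_k^i\in[\mathfrak{g}^{\otimes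 k}]^{\mathfrak{g}}$ and $P_1,\dots,P_k\in\mathbb{C}[t]$, define $\theta(P_1,\dots,P_k):=\sum_i x_1^i(P_1)\cdots x_k^i(P_k)\in U(\mathfrak{g}[t])$ (for $k=0$, $\theta$ is a scalar regarded as an element of $U(\mathfrak{g}[t])$). For non-negative integers $n_1,\dots,n_k$, $\theta(n_1,\dots,n_k)$ denotes $\theta(t^{n_1},\dots,t^{n_k})$. *)

theory Defs
  imports Complex_Main "HOL-Library.Poly_Mapping" "HOL-Computational_Algebra.Polynomial"
begin

section \<open>Complex vector spaces and associative algebras\<close>

class complex_vector = ab_group_add +
  fixes scaleC :: "complex \<Rightarrow> 'a \<Rightarrow> 'a"  (infixr \<open>*\<^sub>C\<close> 75)
  assumes scaleC_add_right: "c *\<^sub>C (x + y) = c *\<^sub>C x + c *\<^sub>C y"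
    and scaleC_add_left: "(c + d) *\<^sub>C x = c *\<^sub>C x + d *\<^sub>C x"
    and scaleC_scaleC: "c *\<^sub>C d *\<^sub>C x = (c * d) *\<^sub>C x"
    and scaleC_one: "1 *\<^sub>C x = x"

interpretation cvec: vector_space "scaleC :: complex \<Rightarrow> 'a \<Rightarrow> 'a::complex_vector"
  by unfold_locales (fact scaleC_add_right scaleC_add_left scaleC_scaleC scaleC_one)+

class complex_algebra_1 = complex_vector + ring_1 +
  assumes mult_scaleC_left: "(c *\<^sub>C x) * y = c *\<^sub>C (x * y)"
    and mult_scaleC_right: "x * (c *\<^sub>C y) = c *\<^sub>C (x * y)"

definition complex_linear :: "('a::complex_vector \<Rightarrow> 'b::complex_vector) \<Rightarrow> bool"
  where "complex_linear f \<longleftrightarrow> Vector_Spaces.linear scaleC scaleC f"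

lemma complex_linearI:
  "(\<And>x y. f (x + y) = f x + f y) \<Longrightarrow> (\<And>c x. f (c *\<^sub>C x) = c *\<^sub>C f x) \<Longrightarrow> complex_linear f"
  unfolding complex_linear_def by unfold_locales

lemma
  assumes "complex_linear f"
  shows complex_linear_add: "f (x + y) = f x + f y"
    and complex_linear_scaleC: "f (c *\<^sub>C x) = c *\<^sub>C f x"
    and complex_linear_diff: "f (x - y) = f x - f y"
    and complex_linear_zero: "f 0 = 0"
    and complex_linear_sum: "f (sum g A) = (\<Sum>a\<in>A. f (g a))"
proof -
  interpret Vector_Spaces.linear scaleC scaleC f
    using assms by (simp add: complex_linear_def)
  show "f (x + y) = f x + f y" "f (c *\<^sub>C x) = c *\<^sub>C f x" "f (x - y) = f x - f y" "f 0 = 0"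
    "f (sum g A) = (\<Sum>a\<in>A. f (g a))"
    by (fact add scale diff zero sum)+
qed

definition complex_subalgebra :: "'a::complex_algebra_1 set \<Rightarrow> bool"
  where "complex_subalgebra A \<longleftrightarrow> cvec.subspace A \<and> 1 \<in> A \<and> (\<forall>x\<in>A. \<forall>y\<in>A. x * y \<in> A)"

text \<open>The two-sided ideal generated by \<open>S\<close>, i.e. all finite sums of elements \<open>u * s * v\<close>
  with \<open>s \<in> S\<close>.\<close>

inductive_set ideal_hull :: "'a::ring_1 set \<Rightarrow> 'a set" for S
  where
    zero: "0 \<in> ideal_hull S"
  | step: "s \<in> S \<Longrightarrow> x \<in> ideal_hull S \<Longrightarrow> u * s * v + x \<in> ideal_hull S"

lemma ideal_hull_add:
  "x \<in> ideal_hull S \<Longrightarrow> y \<in> ideal_hull S \<Longrightarrow> x + y \<in> ideal_hull S"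
  by (induction rule: ideal_hull.induct) (auto simp: add.assoc intro: ideal_hull.step)

lemma ideal_hull_mult_left: "x \<in> ideal_hull S \<Longrightarrow> a * x \<in> ideal_hull S"
proof (induction rule: ideal_hull.induct)
  case (step s x u v)
  then show ?case
    using ideal_hull.step[of s S "a * x" "a * u" v] by (simp add: algebra_simps)
qed (simp add: ideal_hull.zero)

lemma ideal_hull_mult_right: "x \<in> ideal_hull S \<Longrightarrow> x * a \<in> ideal_hull S"
proof (induction rule: ideal_hull.induct)
  case (step s x u v)
  then show ?case
    using ideal_hull.step[of s S "x * a" u "v * a"] by (simp add: algebra_simps)
qed (simp add: ideal_hull.zero)

lemma ideal_hull_minus: "x \<in> ideal_hull S \<Longrightarrow> - x \<in> ideal_hull S"
  using ideal_hull_mult_left[of x S "- 1"] by simp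

lemma ideal_hull_diff:
  "x \<in> ideal_hull S \<Longrightarrow> y \<in> ideal_hull S \<Longrightarrow> x - y \<in> ideal_hull S"
  using ideal_hull_add[of x S "- y"] ideal_hull_minus[of y S] by simp

lemma ideal_hull_scaleC:
  fixes x :: "'a::complex_algebra_1"
  assumes "x \<in> ideal_hull S" shows "c *\<^sub>C x \<in> ideal_hull S"
  using ideal_hull_mult_left[OF assms, of "c *\<^sub>C 1"] by (simp add: mult_scaleC_left)

lemma ideal_hull_base: "s \<in> S \<Longrightarrow> s \<in> ideal_hull S"
  using ideal_hull.step[OF _ ideal_hull.zero, of s S 1 1] by simp

lemma ideal_hull_equivp: "equivp (\<lambda>x y. x - y \<in> ideal_hull S)"
proof (rule equivpI)
  show "reflp (\<lambda>x y. x - y \<in> ideal_hull S)"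
    by (simp add: reflp_def ideal_hull.zero)
  show "symp (\<lambda>x y. x - y \<in> ideal_hull S)"
    by (rule sympI) (use ideal_hull_minus in fastforce)
  show "transp (\<lambda>x y. x - y \<in> ideal_hull S)"
  proof (rule transpI)
    fix x y z assume "x - y \<in> ideal_hull S" "y - z \<in> ideal_hull S"
    from ideal_hull_add[OF this] show "x - z \<in> ideal_hull S" by simp
  qed
qed

lemma ideal_hull_mult_cong:
  assumes "a - a' \<in> ideal_hull S" "b - b' \<in> ideal_hull S"
  shows "a * b - a' * b' \<in> ideal_hull S"
proof -
  have "a * b - a' * b' = (a - a') * b + a' * (b - b')"
    by (simp add: algebra_simps)
  then show ?thesis
    using assms by (simp add: ideal_hull_add ideal_hull_mult_left ideal_hull_mult_right)
qed

lemma ideal_hull_add_cong: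
  assumes "a - a' \<in> ideal_hull S" "b - b' \<in> ideal_hull S"
  shows "(a + b) - (a' + b') \<in> ideal_hull S"
  using ideal_hull_add[OF assms] by (simp add: algebra_simps)

lemma ideal_hull_diff_cong:
  assumes "a - a' \<in> ideal_hull S" "b - b' \<in> ideal_hull S"
  shows "(a - b) - (a' - b') \<in> ideal_hull S"
  using ideal_hull_diff[OF assms] by (simp add: algebra_simps)

lemma ideal_hull_minus_cong:
  assumes "a - a' \<in> ideal_hull S"
  shows "- a - - a' \<in> ideal_hull S"
  using ideal_hull_minus[OF assms] by (simp add: algebra_simps)

lemma ideal_hull_scaleC_cong:
  fixes a :: "'a::complex_algebra_1"
  assumes "a - a' \<in> ideal_hull S"
  shows "c *\<^sub>C a - c *\<^sub>C a' \<in> ideal_hull S"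
  using ideal_hull_scaleC[OF assms, of c] by (simp add: cvec.scale_right_diff_distrib)

instantiation complex :: complex_vector
begin
definition scaleC_complex :: "complex \<Rightarrow> complex \<Rightarrow> complex" where "c *\<^sub>C x = c * x"
instance by standard (simp_all add: scaleC_complex_def algebra_simps)
end

section \<open>Lie algebras\<close>

class complex_lie_algebra = complex_vector +
  fixes lie_bracket :: "'a \<Rightarrow> 'a \<Rightarrow> 'a"
  assumes bracket_add_left: "lie_bracket (x + y) z = lie_bracket x z + lie_bracket y z"
    and bracket_add_right: "lie_bracket x (y + z) = lie_bracket x y + lie_bracket x z"
    and bracket_scaleC_left: "lie_bracket (c *\<^sub>C x) y = c *\<^sub>C lie_bracket x y"
    and bracket_scaleC_right: "lie_bracket x (c *\<^sub>C y) = c *\<^sub>C lie_bracket x y"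
    and bracket_self: "lie_bracket x x = 0"
    and jacobi: "lie_bracket x (lie_bracket y z) + lie_bracket y (lie_bracket z x)
      + lie_bracket z (lie_bracket x y) = 0"

lemma complex_linear_bracket_left: "complex_linear (\<lambda>x. lie_bracket x y)"
  by (rule complex_linearI) (simp_all add: bracket_add_left bracket_scaleC_left)

lemma complex_linear_bracket_right: "complex_linear (lie_bracket x)"
  by (rule complex_linearI) (simp_all add: bracket_add_right bracket_scaleC_right)

lemmas bracket_zero_left [simp] = complex_linear_zero[OF complex_linear_bracket_left]
  and bracket_zero_right [simp] = complex_linear_zero[OF complex_linear_bracket_right]
  and bracket_sum_left = complex_linear_sum[OF complex_linear_bracket_left]
  and bracket_sum_right = complex_linear_sum[OF complex_linear_bracket_right]

lemma bracket_swap: "lie_bracket x y = - lie_bracket y (x :: 'g::complex_lie_algebra)"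
proof -
  have "lie_bracket x (x + y) + lie_bracket y (x + y) = 0"
    by (simp only: bracket_self bracket_add_left[symmetric])
  then have "lie_bracket x y + lie_bracket y x = 0"
    by (simp add: bracket_add_right bracket_self)
  then show ?thesis by (simp add: eq_neg_iff_add_eq_0)
qed

definition lie_ideal :: "'g::complex_lie_algebra set \<Rightarrow> bool"
  where "lie_ideal I \<longleftrightarrow> cvec.subspace I \<and> (\<forall>x. \<forall>y\<in>I. lie_bracket x y \<in> I)"

definition finite_dimensional :: "'a::complex_vector itself \<Rightarrow> bool"
  where "finite_dimensional _ \<longleftrightarrow> (\<exists>S :: 'a set. finite S \<and> cvec.span S = UNIV)"

text \<open>Reductive: the adjoint representation is completely reducible. Its subrepresentations
  are the ideals, so every ideal must have a complementary ideal.\<close>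

definition reductive :: "'g::complex_lie_algebra itself \<Rightarrow> bool"
  where "reductive _ \<longleftrightarrow>
    (\<forall>I :: 'g set. lie_ideal I \<longrightarrow>
      (\<exists>J. lie_ideal J \<and> I \<inter> J = {0} \<and> {a + b | a b. a \<in> I \<and> b \<in> J} = UNIV))"

section \<open>The current Lie algebra\<close>

text \<open>\<open>V \<otimes> \<complex>[t]\<close> is realised as the space of polynomials with coefficients in \<open>V\<close>; the pure
  tensor \<open>x \<otimes> P\<close> is \<open>current x P\<close>. The lemma \<open>current_universal\<close> below shows that this has the
  universal property of the tensor product.\<close>

instantiation poly :: (complex_vector) complex_vector
begin
definition scaleC_poly :: "complex \<Rightarrow> 'a poly \<Rightarrow> 'a poly"
  where "c *\<^sub>C p = map_poly (scaleC c) p"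

lemma coeff_scaleC [simp]: "coeff (c *\<^sub>C p) n = c *\<^sub>C coeff p n"
  by (simp add: scaleC_poly_def coeff_map_poly)

instance
  by standard (simp_all add: poly_eq_iff scaleC_add_right scaleC_add_left)
end

lemma degree_scaleC_le: "degree (c *\<^sub>C p) \<le> degree p"
  by (rule degree_le) (simp add: coeff_eq_0)

lemma scaleC_complex_poly: "c *\<^sub>C (P :: complex poly) = smult c P"
  by (simp add: poly_eq_iff scaleC_complex_def)

definition current :: "'v::complex_vector \<Rightarrow> complex poly \<Rightarrow> 'v poly"
  where "current x P = map_poly (\<lambda>c. c *\<^sub>C x) P"

lemma coeff_current [simp]: "coeff (current x P) n = coeff P n *\<^sub>C x"
  by (simp add: current_def coeff_map_poly)

lemma current_add_left: "current (x + y) P = current x P + current y P"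
  and current_add_right: "current x (P + Q) = current x P + current x Q"
  and current_scaleC_left: "current (c *\<^sub>C x) P = c *\<^sub>C current x P"
  and current_scaleC_right: "current x (c *\<^sub>C P) = c *\<^sub>C current x P"
  by (simp_all add: poly_eq_iff scaleC_add_right scaleC_add_left scaleC_complex_def
      mult.commute)

lemma current_monom: "current x (monom 1 n) = monom x n"
  by (simp add: poly_eq_iff)

lemma current_universal:
  fixes f :: "'v::complex_vector \<Rightarrow> complex poly \<Rightarrow> 'w::complex_vector"
  assumes lin1: "\<And>P. complex_linear (\<lambda>x. f x P)" and lin2: "\<And>x. complex_linear (f x)"
  shows "\<exists>!h. complex_linear h \<and> (\<forall>x P. h (current x P) = f x P)"
proof (rule ex1I)
  define h where "h p = (\<Sum>i\<le>degree p. f (coeff p i) (monom 1 i))" for p :: "'v poly"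
  have h: "h p = (\<Sum>i\<le>n. f (coeff p i) (monom 1 i))" if "degree p \<le> n" for p n
    unfolding h_def using that
    by (intro sum.mono_neutral_left) (auto simp: coeff_eq_0 complex_linear_zero[OF lin1])
  show "complex_linear h \<and> (\<forall>x P. h (current x P) = f x P)"
  proof (intro conjI allI complex_linearI)
    fix p q :: "'v poly" and c :: complex
    define n where "n = max (degree p) (degree q)"
    have "degree (p + q) \<le> n" unfolding n_def by (rule degree_add_le_max)
    then show "h (p + q) = h p + h q"
      by (simp add: h[of _ n] n_def sum.distrib complex_linear_add[OF lin1])
    have "degree (c *\<^sub>C p) \<le> degree p"
      by (rule degree_scaleC_le)
    then show "h (c *\<^sub>C p) = c *\<^sub>C h p"
      by (simp add: h[of _ "degree p"] complex_linear_scaleC[OF lin1] cvec.scale_sum_right)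
  next
    fix x :: 'v and P :: "complex poly"
    have "degree (current x P) \<le> degree P"
      by (intro degree_le) (simp add: coeff_eq_0)
    then have "h (current x P) = (\<Sum>i\<le>degree P. f x (coeff P i *\<^sub>C monom 1 i))"
      by (simp add: h complex_linear_scaleC[OF lin1] complex_linear_scaleC[OF lin2])
    also have "\<dots> = f x (\<Sum>i\<le>degree P. coeff P i *\<^sub>C monom 1 i)"
      by (simp add: complex_linear_sum[OF lin2])
    also have "(\<Sum>i\<le>degree P. coeff P i *\<^sub>C monom 1 i) = P"
      by (simp add: scaleC_complex_poly smult_monom poly_as_sum_of_monoms)
    finally show "h (current x P) = f x P" .
  qed
  fix g assume g: "complex_linear g \<and> (\<forall>x P. g (current x P) = f x P)"
  show "g = h"
  proof
    fix p :: "'v poly"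
    have "g p = g (\<Sum>i\<le>degree p. monom (coeff p i) i)"
      by (simp add: poly_as_sum_of_monoms)
    also have "\<dots> = (\<Sum>i\<le>degree p. g (current (coeff p i) (monom 1 i)))"
      using g by (simp add: complex_linear_sum current_monom)
    also have "\<dots> = h p" using g by (simp add: h_def)
    finally show "g p = h p" .
  qed
qed

lemma poly_additive_eqI:
  fixes f g :: "'a::ab_group_add poly \<Rightarrow> 'b::ab_group_add"
  assumes "\<And>p q. f (p + q) = f p + f q" "\<And>p q. g (p + q) = g p + g q"
    and mon: "\<And>x n. f (monom x n) = g (monom x n)"
  shows "f p = g p"
proof -
  have f: "f (sum h A) = (\<Sum>a\<in>A. f (h a))" for h and A :: "nat set"
    by (rule additive.sum) (simp add: additive_def assms)
  have g: "g (sum h A) = (\<Sum>a\<in>A. g (h a))" for h and A :: "nat set"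
    by (rule additive.sum) (simp add: additive_def assms)
  show ?thesis
    using f[of "\<lambda>i. monom (coeff p i) i" "{..degree p}"]
      g[of "\<lambda>i. monom (coeff p i) i" "{..degree p}"]
    by (simp add: poly_as_sum_of_monoms mon)
qed

instantiation poly :: (complex_lie_algebra) complex_lie_algebra
begin

definition lie_bracket_poly :: "'a poly \<Rightarrow> 'a poly \<Rightarrow> 'a poly" where
  "lie_bracket_poly p q =
    (\<Sum>i\<le>degree p. \<Sum>j\<le>degree q. monom (lie_bracket (coeff p i) (coeff q j)) (i + j))"

lemma lie_bracket_poly_bound:
  fixes p q :: "'a poly"
  assumes "degree p \<le> m" "degree q \<le> n"
  shows "lie_bracket p q =
    (\<Sum>i\<le>m. \<Sum>j\<le>n. monom (lie_bracket (coeff p i) (coeff q j)) (i + j))"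
proof -
  have "lie_bracket p q =
    (\<Sum>i\<le>m. \<Sum>j\<le>degree q. monom (lie_bracket (coeff p i) (coeff q j)) (i + j))"
    unfolding lie_bracket_poly_def using assms
    by (intro sum.mono_neutral_left) (auto simp: coeff_eq_0)
  also have "\<dots> = (\<Sum>i\<le>m. \<Sum>j\<le>n. monom (lie_bracket (coeff p i) (coeff q j)) (i + j))"
    using assms by (intro sum.cong refl sum.mono_neutral_left) (auto simp: coeff_eq_0)
  finally show ?thesis .
qed

lemma lie_bracket_poly_add_left:
  fixes p q r :: "'a poly"
  shows "lie_bracket (p + q) r = lie_bracket p r + lie_bracket q r"
proof -
  define m where "m = max (degree p) (degree q)"
  have "degree (p + q) \<le> m" unfolding m_def by (rule degree_add_le_max)
  then show ?thesis
    by (simp add: lie_bracket_poly_bound[of _ m r "degree r"] m_def bracket_add_left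
        add_monom[symmetric] sum.distrib)
qed

lemma lie_bracket_poly_add_right:
  fixes p q r :: "'a poly"
  shows "lie_bracket r (p + q) = lie_bracket r p + lie_bracket r q"
proof -
  define m where "m = max (degree p) (degree q)"
  have "degree (p + q) \<le> m" unfolding m_def by (rule degree_add_le_max)
  then show ?thesis
    by (simp add: lie_bracket_poly_bound[of r "degree r" _ m] m_def bracket_add_right
        add_monom[symmetric] sum.distrib)
qed

lemma scaleC_monom: "monom (c *\<^sub>C x) n = c *\<^sub>C monom (x::'a) n"
  by (simp add: poly_eq_iff)

lemma lie_bracket_poly_scaleC_left: "lie_bracket (c *\<^sub>C p) q = c *\<^sub>C lie_bracket p (q :: 'a poly)"
proof -
  have "degree (c *\<^sub>C p) \<le> degree p"
    by (rule degree_scaleC_le)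
  then show ?thesis
    by (simp add: lie_bracket_poly_bound[of _ "degree p" q "degree q"] bracket_scaleC_left
        scaleC_monom cvec.scale_sum_right)
qed

lemma lie_bracket_poly_scaleC_right: "lie_bracket p (c *\<^sub>C q) = c *\<^sub>C lie_bracket p (q :: 'a poly)"
proof -
  have "degree (c *\<^sub>C q) \<le> degree q"
    by (rule degree_scaleC_le)
  then show ?thesis
    by (simp add: lie_bracket_poly_bound[of p "degree p" _ "degree q"] bracket_scaleC_right
        scaleC_monom cvec.scale_sum_right)
qed

lemma lie_bracket_monom:
  "lie_bracket (monom x m) (monom y n) = monom (lie_bracket x (y::'a)) (m + n)"
proof -
  have "lie_bracket (monom x m) (monom y n) = (\<Sum>i\<le>m. \<Sum>j\<le>n.
      monom (lie_bracket (coeff (monom x m) i) (coeff (monom y n) j)) (i + j))"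
    by (intro lie_bracket_poly_bound degree_monom_le)
  also have "\<dots> = (\<Sum>i\<le>m. \<Sum>j\<le>n.
      if j = n then if i = m then monom (lie_bracket x y) (m + n) else 0 else 0)"
    by (intro sum.cong refl) simp
  also have "\<dots> = monom (lie_bracket x y) (m + n)"
    by simp
  finally show ?thesis .
qed

instance
proof
  fix p q r :: "'a poly" and c :: complex
  show add: "lie_bracket (p + q) r = lie_bracket p r + lie_bracket q r"
    "lie_bracket p (q + r) = lie_bracket p q + lie_bracket p r" for p q r :: "'a poly"
    by (fact lie_bracket_poly_add_left lie_bracket_poly_add_right)+
  show "lie_bracket (c *\<^sub>C p) q = c *\<^sub>C lie_bracket p q"
    "lie_bracket p (c *\<^sub>C q) = c *\<^sub>C lie_bracket p q"
    by (fact lie_bracket_poly_scaleC_left lie_bracket_poly_scaleC_right)+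
  have swap: "lie_bracket p q = - lie_bracket q p" for p q :: "'a poly"
  proof (rule poly_additive_eqI[where p = p])
    fix x m
    show "lie_bracket (monom x m) q = - lie_bracket q (monom x m)"
    proof (rule poly_additive_eqI[where p = q])
      fix y n
      show "lie_bracket (monom x m) (monom y n) = - lie_bracket (monom y n) (monom x m)"
        by (simp add: lie_bracket_monom bracket_swap[of x y] minus_monom add.commute)
    qed (simp_all add: add)
  qed (simp_all add: add)
  then have "lie_bracket p p + lie_bracket p p = 0"
    by (metis add.right_inverse)
  then have "(2::complex) *\<^sub>C lie_bracket p p = 0"
    by (metis one_add_one scaleC_add_left scaleC_one)
  then show "lie_bracket p p = 0" by simp
  show "lie_bracket p (lie_bracket q r) + lie_bracket q (lie_bracket r p)
      + lie_bracket r (lie_bracket p q) = 0"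
  proof (rule poly_additive_eqI[where p = p])
    fix x l
    show "lie_bracket (monom x l) (lie_bracket q r) + lie_bracket q (lie_bracket r (monom x l))
      + lie_bracket r (lie_bracket (monom x l) q) = 0"
    proof (rule poly_additive_eqI[where p = q])
      fix y m
      show "lie_bracket (monom x l) (lie_bracket (monom y m) r)
        + lie_bracket (monom y m) (lie_bracket r (monom x l))
        + lie_bracket r (lie_bracket (monom x l) (monom y m)) = 0"
      proof (rule poly_additive_eqI[where p = r])
        fix z n
        show "lie_bracket (monom x l) (lie_bracket (monom y m) (monom z n))
          + lie_bracket (monom y m) (lie_bracket (monom z n) (monom x l))
          + lie_bracket (monom z n) (lie_bracket (monom x l) (monom y m)) = 0"
          using jacobi[of x y z] by (simp add: lie_bracket_monom add_monom ac_simps)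
      qed (simp_all add: add algebra_simps)
    qed (simp_all add: add algebra_simps)
  qed (simp_all add: add algebra_simps)
qed

end

lemma bracket_current:
  fixes x y :: "'g::complex_lie_algebra"
  shows "lie_bracket (current x P) (current y Q) = current (lie_bracket x y) (P * Q)"
proof (rule poly_additive_eqI[where p = P])
  fix a m
  show "lie_bracket (current x (monom a m)) (current y Q)
    = current (lie_bracket x y) (monom a m * Q)"
  proof (rule poly_additive_eqI[where p = Q])
    fix b n
    have cm: "current u (monom c k) = monom (c *\<^sub>C u) k" for u :: 'g and c k
      by (simp add: poly_eq_iff)
    show "lie_bracket (current x (monom a m)) (current y (monom b n))
      = current (lie_bracket x y) (monom a m * monom b n)"
      by (simp add: cm lie_bracket_monom mult_monom bracket_scaleC_left bracket_scaleC_right)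
  qed (simp_all add: current_add_right bracket_add_right distrib_left)
qed (simp_all add: current_add_right bracket_add_left distrib_right)

section \<open>The tensor algebra\<close>

text \<open>The free associative algebra on the set \<open>V\<close> is the monoid algebra of the free monoid on
  \<open>V\<close>, written additively as \<^typ>\<open>'a \<Rightarrow>\<^sub>0 complex\<close> requires.\<close>

datatype 'a free_monoid = Word "'a list"

instantiation free_monoid :: (type) monoid_add
begin
definition "0 = Word []"
fun plus_free_monoid :: "'a free_monoid \<Rightarrow> 'a free_monoid \<Rightarrow> 'a free_monoid"
  where "Word u + Word v = Word (u @ v)"
instance
proof
  fix a b c :: "'a free_monoid"
  show "a + b + c = a + (b + c)" by (cases a; cases b; cases c) simp
  show "0 + a = a" "a + 0 = a" by (cases a; simp add: zero_free_monoid_def)+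
qed
end

type_synonym 'a free_algebra = "'a free_monoid \<Rightarrow>\<^sub>0 complex"

instantiation poly_mapping :: (type, complex_vector) complex_vector
begin
lift_definition scaleC_poly_mapping :: "complex \<Rightarrow> ('a \<Rightarrow>\<^sub>0 'b) \<Rightarrow> 'a \<Rightarrow>\<^sub>0 'b"
  is "\<lambda>c f k. c *\<^sub>C f k"
  by (erule rev_finite_subset) auto
instance
  by standard (transfer; simp add: fun_eq_iff scaleC_add_right scaleC_add_left)+
end

lemma lookup_scaleC: "Poly_Mapping.lookup (c *\<^sub>C p) k = c *\<^sub>C Poly_Mapping.lookup p k"
  by transfer simp

instance complex :: complex_algebra_1
  by standard (simp_all add: scaleC_complex_def)

lemma poly_mapping_sum_singles:
  "(\<Sum>k\<in>Poly_Mapping.keys p. Poly_Mapping.single k (Poly_Mapping.lookup p k)) = p"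
  by (rule poly_mapping_eqI)
    (simp add: lookup_sum lookup_single when_def in_keys_iff sum.delta)

lemma scaleC_eq_single_mult:
  fixes p :: "'a::monoid_add \<Rightarrow>\<^sub>0 'b::complex_algebra_1"
  shows "c *\<^sub>C p = Poly_Mapping.single 0 (c *\<^sub>C 1) * p"
proof -
  have "c *\<^sub>C p = Poly_Mapping.map ((*) (c *\<^sub>C 1)) p"
    by (rule poly_mapping_eqI)
      (simp add: lookup_scaleC mult_scaleC_left Poly_Mapping.map.rep_eq when_def)
  then show ?thesis by (simp add: mult_map_scale_conv_mult)
qed

lemma single_scalar_commute:
  fixes p :: "'a::monoid_add \<Rightarrow>\<^sub>0 'b::complex_algebra_1"
  shows "p * Poly_Mapping.single 0 (c *\<^sub>C 1) = Poly_Mapping.single 0 (c *\<^sub>C 1) * p"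
proof -
  have "(\<Sum>k\<in>Poly_Mapping.keys p. Poly_Mapping.single k (Poly_Mapping.lookup p k)) *
      Poly_Mapping.single 0 (c *\<^sub>C 1) = Poly_Mapping.single 0 (c *\<^sub>C 1) *
      (\<Sum>k\<in>Poly_Mapping.keys p. Poly_Mapping.single k (Poly_Mapping.lookup p k))"
    by (simp add: sum_distrib_left sum_distrib_right mult_single mult_scaleC_left
        mult_scaleC_right)
  then show ?thesis by (simp add: poly_mapping_sum_singles)
qed

instance poly_mapping :: (monoid_add, complex_algebra_1) complex_algebra_1
proof
  fix p q :: "'a \<Rightarrow>\<^sub>0 'b" and c :: complex
  show "c *\<^sub>C p * q = c *\<^sub>C (p * q)"
    by (simp add: scaleC_eq_single_mult mult.assoc)
  show "p * c *\<^sub>C q = c *\<^sub>C (p * q)"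
    unfolding scaleC_eq_single_mult mult.assoc[symmetric] single_scalar_commute ..
qed

definition lin_ext :: "('a list \<Rightarrow> 'b::complex_vector) \<Rightarrow> 'a free_algebra \<Rightarrow> 'b"
  where "lin_ext f p = (\<Sum>w\<in>{w. Word w \<in> Poly_Mapping.keys p}. Poly_Mapping.lookup p (Word w) *\<^sub>C f w)"

lemma finite_words: "finite {w. Word w \<in> Poly_Mapping.keys p}"
  by (rule finite_vimageI[of _ Word, unfolded vimage_def]) (simp_all add: inj_def)

lemma lin_ext_superset:
  assumes "finite A" "{w. Word w \<in> Poly_Mapping.keys p} \<subseteq> A"
  shows "lin_ext f p = (\<Sum>w\<in>A. Poly_Mapping.lookup p (Word w) *\<^sub>C f w)"
  unfolding lin_ext_def using assms
  by (intro sum.mono_neutral_left) (auto simp: in_keys_iff)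

lemma complex_linear_lin_ext: "complex_linear (lin_ext f)"
proof (rule complex_linearI)
  fix p q :: "'a free_algebra" and c
  let ?A = "{w. Word w \<in> Poly_Mapping.keys p} \<union> {w. Word w \<in> Poly_Mapping.keys q}"
  have "finite ?A" by (simp add: finite_words)
  moreover have "{w. Word w \<in> Poly_Mapping.keys (p + q)} \<subseteq> ?A"
    using keys_add[of p q] by auto
  ultimately show "lin_ext f (p + q) = lin_ext f p + lin_ext f q"
    by (simp add: lin_ext_superset[of ?A] lookup_add scaleC_add_left sum.distrib)
  have "{w. Word w \<in> Poly_Mapping.keys (c *\<^sub>C p)} \<subseteq> {w. Word w \<in> Poly_Mapping.keys p}"
    by (auto simp: in_keys_iff lookup_scaleC)
  from lin_ext_superset[OF finite_words this]
  show "lin_ext f (c *\<^sub>C p) = c *\<^sub>C lin_ext f p"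
    by (simp add: lin_ext_def lookup_scaleC scaleC_complex_def cvec.scale_sum_right)
qed

lemma lin_ext_single: "lin_ext f (Poly_Mapping.single (Word w) c) = c *\<^sub>C f w"
  by (subst lin_ext_superset[of "{w}"]) (auto split: if_splits)

lemma free_algebra_expand:
  "x = (\<Sum>k\<in>Poly_Mapping.keys x. Poly_Mapping.lookup x k *\<^sub>C Poly_Mapping.single k 1)"
  for x :: "'a free_algebra"
proof -
  have "Poly_Mapping.single k c = c *\<^sub>C Poly_Mapping.single k (1::complex)"
    for k :: "'a free_monoid" and c
    by (rule poly_mapping_eqI) (simp add: lookup_scaleC lookup_single when_def scaleC_complex_def)
  from this[symmetric] show ?thesis
    by (simp only: poly_mapping_sum_singles)
qed

text \<open>A linear map on the free algebra vanishes on an ideal as soon as it vanishes on the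
  generators multiplied by words from both sides.\<close>

lemma linear_vanishes_on_ideal:
  fixes F :: "'a free_algebra \<Rightarrow> 'b::complex_vector"
  assumes lin: "complex_linear F"
    and gen: "\<And>r u v. r \<in> R \<Longrightarrow>
      F (Poly_Mapping.single (Word u) 1 * r * Poly_Mapping.single (Word v) 1) = 0"
    and "p \<in> ideal_hull R"
  shows "F p = 0"
  using assms(3)
proof (induction rule: ideal_hull.induct)
  case zero
  show ?case by (rule complex_linear_zero[OF lin])
next
  case (step r p u v)
  have *: "F (Poly_Mapping.single k 1 * r * Poly_Mapping.single l 1) = 0" for k l
    using gen[OF step.hyps(1)] by (cases k; cases l) simp
  have "F (u * r * v) = 0"
    by (subst free_algebra_expand[of u], subst free_algebra_expand[of v])
      (simp add: sum_distrib_left sum_distrib_right mult_scaleC_left mult_scaleC_right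
        complex_linear_sum[OF lin] complex_linear_scaleC[OF lin] *)
  with step.IH show ?case by (simp add: complex_linear_add[OF lin])
qed

definition letter :: "'a \<Rightarrow> 'a free_algebra"
  where "letter x = Poly_Mapping.single (Word [x]) 1"

text \<open>\<open>T(V)\<close> is the free algebra on the set \<open>V\<close> modulo the linear relations of \<open>V\<close>.\<close>

definition linear_relations :: "'a::complex_vector free_algebra set"
  where "linear_relations =
    {letter (x + y) - letter x - letter y | x y. True} \<union>
    {letter (c *\<^sub>C x) - c *\<^sub>C letter x | c x. True}"

quotient_type (overloaded) 'a tensor_algebra = "'a::complex_vector free_algebra" /
  "\<lambda>p q. p - q \<in> ideal_hull linear_relations"
  by (rule ideal_hull_equivp)

lemma lin_ext_linear_relations:
  assumes add: "\<And>u x y v. f (u @ (x + y) # v) = f (u @ x # v) + f (u @ y # v)"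
    and scale: "\<And>u c x v. f (u @ (c *\<^sub>C x) # v) = c *\<^sub>C f (u @ x # v)"
    and p: "p \<in> ideal_hull linear_relations"
  shows "lin_ext f p = 0"
  using complex_linear_lin_ext _ p
proof (rule linear_vanishes_on_ideal)
  note lin = complex_linear_lin_ext[of f]
  fix r :: "'a free_algebra" and u v
  assume "r \<in> linear_relations"
  then consider x y where "r = letter (x + y) - letter x - letter y"
    | c x where "r = letter (c *\<^sub>C x) - c *\<^sub>C letter x"
    by (auto simp: linear_relations_def)
  then show "lin_ext f (Poly_Mapping.single (Word u) 1 * r * Poly_Mapping.single (Word v) 1) = 0"
    by cases (simp_all add: letter_def left_diff_distrib right_diff_distrib mult_single
        mult_scaleC_left mult_scaleC_right complex_linear_diff[OF lin]
        complex_linear_scaleC[OF lin] lin_ext_single scaleC_one add scale)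
qed

lemma one_notin_linear_relations: "1 \<notin> ideal_hull (linear_relations :: 'a::complex_vector free_algebra set)"
proof
  let ?f = "\<lambda>w :: 'a list. if w = [] then 1 else 0 :: complex"
  assume "1 \<in> ideal_hull (linear_relations :: 'a free_algebra set)"
  then have "lin_ext ?f 1 = 0" by (rule lin_ext_linear_relations[rotated 2]) simp_all
  moreover have "lin_ext ?f 1 = 1"
    using lin_ext_single[of ?f "[]" 1] by (simp add: zero_free_monoid_def[symmetric] scaleC_one)
  ultimately show False by simp
qed

instantiation tensor_algebra :: (complex_vector) complex_algebra_1
begin
lift_definition zero_tensor_algebra :: "'a tensor_algebra" is 0 .
lift_definition one_tensor_algebra :: "'a tensor_algebra" is 1 .
lift_definition plus_tensor_algebra :: "'a tensor_algebra \<Rightarrow> 'a tensor_algebra \<Rightarrow> 'a tensor_algebra"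
  is "(+)" by (rule ideal_hull_add_cong)
lift_definition minus_tensor_algebra :: "'a tensor_algebra \<Rightarrow> 'a tensor_algebra \<Rightarrow> 'a tensor_algebra"
  is "(-)" by (rule ideal_hull_diff_cong)
lift_definition uminus_tensor_algebra :: "'a tensor_algebra \<Rightarrow> 'a tensor_algebra"
  is uminus by (rule ideal_hull_minus_cong)
lift_definition times_tensor_algebra :: "'a tensor_algebra \<Rightarrow> 'a tensor_algebra \<Rightarrow> 'a tensor_algebra"
  is "(*)" by (rule ideal_hull_mult_cong)
lift_definition scaleC_tensor_algebra :: "complex \<Rightarrow> 'a tensor_algebra \<Rightarrow> 'a tensor_algebra"
  is "scaleC" by (rule ideal_hull_scaleC_cong)
instance
proof
  show "(0 :: 'a tensor_algebra) \<noteq> 1"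
    by transfer (use one_notin_linear_relations ideal_hull_minus in fastforce)
qed (transfer; simp add: algebra_simps ideal_hull.zero cvec.scale_right_distrib
    cvec.scale_left_distrib mult_scaleC_left mult_scaleC_right)+
end

lift_definition tensor_of :: "'a::complex_vector \<Rightarrow> 'a tensor_algebra" is letter .

lemma tensor_of_add: "tensor_of (x + y) = tensor_of x + tensor_of y"
proof transfer
  fix x y :: 'a
  have "letter (x + y) - letter x - letter y \<in> ideal_hull linear_relations"
    by (rule ideal_hull_base) (auto simp: linear_relations_def)
  then show "letter (x + y) - (letter x + letter y) \<in> ideal_hull linear_relations"
    by (simp add: diff_diff_add)
qed

lemma tensor_of_scaleC: "tensor_of (c *\<^sub>C x) = c *\<^sub>C tensor_of x"
  by transfer (rule ideal_hull_base, auto simp: linear_relations_def)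

lemma complex_linear_tensor_of: "complex_linear tensor_of"
  by (rule complex_linearI) (fact tensor_of_add tensor_of_scaleC)+

definition pure_tensor :: "'a::complex_vector list \<Rightarrow> 'a tensor_algebra"
  where "pure_tensor xs = prod_list (map tensor_of xs)"

lemma prod_list_letter: "prod_list (map letter w) = Poly_Mapping.single (Word w) 1"
  by (induction w) (simp_all add: letter_def mult_single zero_free_monoid_def[symmetric])

lemma abs_single: "abs_tensor_algebra (Poly_Mapping.single (Word w) 1) = pure_tensor w"
  unfolding prod_list_letter[symmetric] pure_tensor_def
  by (induction w)
    (simp_all add: one_tensor_algebra.abs_eq times_tensor_algebra.abs_eq[symmetric]
      tensor_of.abs_eq)

definition multilinear :: "('a::complex_vector list \<Rightarrow> 'b::complex_vector) \<Rightarrow> bool"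
  where "multilinear f \<longleftrightarrow> (\<forall>u v. complex_linear (\<lambda>x. f (u @ x # v)))"

lemma multilinearI: "(\<And>u v. complex_linear (\<lambda>x. f (u @ x # v))) \<Longrightarrow> multilinear f"
  by (simp add: multilinear_def)

lemma multilinearD: "multilinear f \<Longrightarrow> complex_linear (\<lambda>x. f (u @ x # v))"
  by (simp add: multilinear_def)

text \<open>The linear map on \<open>T(V)\<close> with \<open>x\<^sub>1 \<otimes> \<dots> \<otimes> x\<^sub>k \<mapsto> f [x\<^sub>1, \<dots>, x\<^sub>k]\<close>, for \<open>f\<close> multilinear in each
  length. The choice of representative is irrelevant by \<open>tensor_lift_abs\<close>.\<close>

definition tensor_lift :: "('a::complex_vector list \<Rightarrow> 'b::complex_vector) \<Rightarrow> 'a tensor_algebra \<Rightarrow> 'b"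
  where "tensor_lift f \<theta> = lin_ext f (rep_tensor_algebra \<theta>)"

lemma tensor_lift_abs:
  assumes "multilinear f"
  shows "tensor_lift f (abs_tensor_algebra p) = lin_ext f p"
proof -
  have "rep_tensor_algebra (abs_tensor_algebra p) - p \<in> ideal_hull linear_relations"
    by (rule rep_abs_rsp_left[OF Quotient3_tensor_algebra]) (simp add: ideal_hull.zero)
  then have "lin_ext f (rep_tensor_algebra (abs_tensor_algebra p) - p) = 0"
    by (intro lin_ext_linear_relations complex_linear_add[OF multilinearD[OF assms]]
        complex_linear_scaleC[OF multilinearD[OF assms]])
  then show ?thesis
    by (simp add: tensor_lift_def complex_linear_diff[OF complex_linear_lin_ext])
qed

lemma tensor_lift_pure: "multilinear f \<Longrightarrow> tensor_lift f (pure_tensor w) = f w"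
  by (simp add: abs_single[symmetric] tensor_lift_abs lin_ext_single scaleC_one)

lemma complex_linear_tensor_lift:
  assumes "multilinear f" shows "complex_linear (tensor_lift f)"
proof (rule complex_linearI)
  fix x y :: "'a tensor_algebra" and c
  show "tensor_lift f (x + y) = tensor_lift f x + tensor_lift f y"
    by (induction x; induction y)
      (simp add: plus_tensor_algebra.abs_eq tensor_lift_abs[OF assms]
        complex_linear_add[OF complex_linear_lin_ext])
  show "tensor_lift f (c *\<^sub>C x) = c *\<^sub>C tensor_lift f x"
    by (induction x)
      (simp add: scaleC_tensor_algebra.abs_eq tensor_lift_abs[OF assms]
        complex_linear_scaleC[OF complex_linear_lin_ext])
qed

lemma complex_linear_id: "complex_linear (\<lambda>x. x)"
  by (rule complex_linearI) simp_all

lemma complex_linear_zero_fun: "complex_linear (\<lambda>x. 0)"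
  by (rule complex_linearI) simp_all

lemma complex_linear_compose:
  "complex_linear f \<Longrightarrow> complex_linear g \<Longrightarrow> complex_linear (\<lambda>x. f (g x))"
  by (rule complex_linearI) (simp_all add: complex_linear_add complex_linear_scaleC)

lemma complex_linear_sum_fun:
  "(\<And>i. i \<in> A \<Longrightarrow> complex_linear (f i)) \<Longrightarrow> complex_linear (\<lambda>x. \<Sum>i\<in>A. f i x)"
  by (rule complex_linearI)
    (simp_all add: complex_linear_add complex_linear_scaleC sum.distrib cvec.scale_sum_right)

lemma complex_linear_mult_fun:
  fixes f :: "'a::complex_vector \<Rightarrow> 'b::complex_algebra_1"
  shows "complex_linear f \<Longrightarrow> complex_linear (\<lambda>x. a * f x * b)"
  by (rule complex_linearI)
    (simp_all add: complex_linear_add complex_linear_scaleC algebra_simps mult_scaleC_left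
      mult_scaleC_right)

lemma multilinear_pure_tensor: "multilinear pure_tensor"
  by (rule multilinearI)
    (simp add: pure_tensor_def mult.assoc[symmetric]
      complex_linear_mult_fun[OF complex_linear_tensor_of])

definition tensor_power :: "nat \<Rightarrow> 'a::complex_vector tensor_algebra set"
  where "tensor_power k = cvec.span {pure_tensor xs | xs. length xs = k}"

definition homogeneous :: "'a::complex_vector tensor_algebra \<Rightarrow> bool"
  where "homogeneous \<theta> \<longleftrightarrow> (\<exists>k. \<theta> \<in> tensor_power k)"

text \<open>The adjoint action of a Lie algebra on its tensor algebra:
  \<open>x \<cdot> (x\<^sub>1 \<otimes> \<dots> \<otimes> x\<^sub>k) = (\<Sum>i. x\<^sub>1 \<otimes> \<dots> \<otimes> [x, x\<^sub>i] \<otimes> \<dots> \<otimes> x\<^sub>k)\<close>.\<close>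

definition tensor_ad :: "'g::complex_lie_algebra \<Rightarrow> 'g tensor_algebra \<Rightarrow> 'g tensor_algebra"
  where "tensor_ad x =
    tensor_lift (\<lambda>w. \<Sum>i<length w. pure_tensor (w[i := lie_bracket x (w ! i)]))"

lemma multilinear_tensor_ad:
  "multilinear (\<lambda>w. \<Sum>i<length w. pure_tensor (w[i := lie_bracket x (w ! i)]))"
proof (rule multilinearI)
  fix u v :: "'a list"
  show "complex_linear (\<lambda>y. \<Sum>i<length (u @ y # v).
      pure_tensor ((u @ y # v)[i := lie_bracket x ((u @ y # v) ! i)]))"
    unfolding length_append length_Cons
  proof (rule complex_linear_sum_fun)
    fix i assume "i \<in> {..<length u + Suc (length v)}"
    have lin: "complex_linear (\<lambda>y :: 'a. pure_tensor (u' @ y # v'))" for u' v'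
      using multilinear_pure_tensor[where ?'a = 'a] unfolding multilinear_def by blast
    consider "i < length u" | "i = length u" | j where "i = length u + Suc j"
      by (metis add_Suc_right less_imp_Suc_add linorder_neqE_nat)
    then show "complex_linear (\<lambda>y.
        pure_tensor ((u @ y # v)[i := lie_bracket x ((u @ y # v) ! i)]))"
    proof cases
      case 1
      then show ?thesis by (simp add: list_update_append nth_append lin)
    next
      case 2
      then show ?thesis
        by (simp add: complex_linear_compose[OF lin complex_linear_bracket_right])
    next
      case 3
      then show ?thesis by (simp add: list_update_append nth_append lin)
    qed
  qed
qed

lemma tensor_ad_pure:
  "tensor_ad x (pure_tensor w) = (\<Sum>i<length w. pure_tensor (w[i := lie_bracket x (w ! i)]))"
  unfolding tensor_ad_def by (rule tensor_lift_pure[OF multilinear_tensor_ad])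

lemma complex_linear_tensor_ad: "complex_linear (tensor_ad x)"
  unfolding tensor_ad_def by (rule complex_linear_tensor_lift[OF multilinear_tensor_ad])

definition tensor_invariants :: "'g::complex_lie_algebra tensor_algebra set"
  where "tensor_invariants = {\<theta>. \<forall>x. tensor_ad x \<theta> = 0}"

section \<open>The universal enveloping algebra\<close>

definition enveloping_relations :: "'g::complex_lie_algebra tensor_algebra set"
  where "enveloping_relations =
    {tensor_of x * tensor_of y - tensor_of y * tensor_of x - tensor_of (lie_bracket x y) | x y. True}"

quotient_type (overloaded) 'g enveloping_algebra = "'g::complex_lie_algebra tensor_algebra" /
  "\<lambda>p q. p - q \<in> ideal_hull enveloping_relations"
  by (rule ideal_hull_equivp)

lemma one_notin_enveloping_relations:
  "1 \<notin> ideal_hull (enveloping_relations :: 'g::complex_lie_algebra tensor_algebra set)"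
proof
  let ?f = "\<lambda>w :: 'g list. if w = [] then 1 else 0 :: complex"
  note lin = complex_linear_lin_ext[of ?f]
  have m: "multilinear ?f"
    by (rule multilinearI) (simp add: complex_linear_zero_fun)
  have single: "lin_ext ?f (Poly_Mapping.single k 1 * Poly_Mapping.single l 1) =
      lin_ext ?f (Poly_Mapping.single k 1) * lin_ext ?f (Poly_Mapping.single l 1)" for k l
    by (cases k; cases l) (simp add: mult_single lin_ext_single scaleC_one)
  have mult: "lin_ext ?f (p * q) = lin_ext ?f p * lin_ext ?f q" for p q
  proof -
    let ?e = "\<lambda>x :: 'g free_algebra.
      \<Sum>k\<in>Poly_Mapping.keys x. Poly_Mapping.lookup x k *\<^sub>C Poly_Mapping.single k 1"
    have "lin_ext ?f (?e p * ?e q) = lin_ext ?f (?e p) * lin_ext ?f (?e q)"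
      by (simp add: sum_distrib_left sum_distrib_right mult_scaleC_left mult_scaleC_right
          complex_linear_sum[OF lin] complex_linear_scaleC[OF lin] single)
    then show ?thesis by (simp only: free_algebra_expand[symmetric])
  qed
  have mult: "tensor_lift ?f (p * q) = tensor_lift ?f p * tensor_lift ?f q" for p q
    by (induction p; induction q)
      (simp add: times_tensor_algebra.abs_eq tensor_lift_abs[OF m] mult)
  have letter: "tensor_lift ?f (tensor_of x) = 0" for x
    by (simp add: tensor_of.abs_eq tensor_lift_abs[OF m] letter_def lin_ext_single)
  note lin = complex_linear_tensor_lift[OF m]
  have "tensor_lift ?f p = 0" if "p \<in> ideal_hull enveloping_relations" for p
    using that
    by induction (auto simp: enveloping_relations_def complex_linear_zero[OF lin]
        complex_linear_add[OF lin] complex_linear_diff[OF lin] mult letter)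
  moreover have "tensor_lift ?f 1 = 1"
    using tensor_lift_pure[OF m, of "[]"] by (simp add: pure_tensor_def)
  moreover assume "1 \<in> ideal_hull (enveloping_relations :: 'g tensor_algebra set)"
  ultimately show False by fastforce
qed

instantiation enveloping_algebra :: (complex_lie_algebra) complex_algebra_1
begin
lift_definition zero_enveloping_algebra :: "'a enveloping_algebra" is 0 .
lift_definition one_enveloping_algebra :: "'a enveloping_algebra" is 1 .
lift_definition plus_enveloping_algebra :: "'a enveloping_algebra \<Rightarrow> 'a enveloping_algebra \<Rightarrow> 'a enveloping_algebra"
  is "(+)" by (rule ideal_hull_add_cong)
lift_definition minus_enveloping_algebra :: "'a enveloping_algebra \<Rightarrow> 'a enveloping_algebra \<Rightarrow> 'a enveloping_algebra"
  is "(-)" by (rule ideal_hull_diff_cong)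
lift_definition uminus_enveloping_algebra :: "'a enveloping_algebra \<Rightarrow> 'a enveloping_algebra"
  is uminus by (rule ideal_hull_minus_cong)
lift_definition times_enveloping_algebra :: "'a enveloping_algebra \<Rightarrow> 'a enveloping_algebra \<Rightarrow> 'a enveloping_algebra"
  is "(*)" by (rule ideal_hull_mult_cong)
lift_definition scaleC_enveloping_algebra :: "complex \<Rightarrow> 'a enveloping_algebra \<Rightarrow> 'a enveloping_algebra"
  is "scaleC" by (rule ideal_hull_scaleC_cong)
instance
proof
  show "(0 :: 'a enveloping_algebra) \<noteq> 1"
    by transfer (use one_notin_enveloping_relations ideal_hull_minus in fastforce)
qed (transfer; simp add: algebra_simps ideal_hull.zero cvec.scale_right_distrib
    cvec.scale_left_distrib mult_scaleC_left mult_scaleC_right)+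
end


lift_definition envelope_of :: "'g::complex_lie_algebra \<Rightarrow> 'g enveloping_algebra" is tensor_of .

lemma complex_linear_envelope_of: "complex_linear envelope_of"
  by (rule complex_linearI; transfer)
    (simp_all add: tensor_of_add tensor_of_scaleC ideal_hull.zero)

lemma envelope_of_commutator:
  "envelope_of x * envelope_of y - envelope_of y * envelope_of x = envelope_of (lie_bracket x y)"
  by transfer (rule ideal_hull_base, auto simp: enveloping_relations_def)

text \<open>\<open>[U(\<gg>[t])]\<^sup>\<gg>\<close>, where \<open>\<gg>\<close> is embedded in \<open>\<gg>[t]\<close> as \<open>x \<mapsto> x \<otimes> 1\<close>.\<close>

definition current_invariants :: "'g::complex_lie_algebra poly enveloping_algebra set"
  where "current_invariants =
    {u. \<forall>x. envelope_of (current x 1) * u - u * envelope_of (current x 1) = 0}"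

text \<open>\<open>\<theta>(P\<^sub>1, \<dots>, P\<^sub>k)\<close> for \<open>\<theta>\<close> of degree \<open>k\<close>; components of other degrees are sent to \<open>0\<close>.\<close>

definition tensor_eval ::
    "'g::complex_lie_algebra tensor_algebra \<Rightarrow> complex poly list \<Rightarrow> 'g poly enveloping_algebra"
  where "tensor_eval \<theta> Ps = tensor_lift (\<lambda>w. if length w = length Ps
    then prod_list (map2 (\<lambda>x P. envelope_of (current x P)) w Ps) else 0) \<theta>"

lemma multilinear_tensor_eval:
  "multilinear (\<lambda>w :: 'g::complex_lie_algebra list. if length w = length Ps
    then prod_list (map2 (\<lambda>x P. envelope_of (current x P)) w Ps) else 0)"
proof (rule multilinearI)
  fix u v :: "'g list"
  show "complex_linear (\<lambda>y. if length (u @ y # v) = length Ps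
    then prod_list (map2 (\<lambda>x P. envelope_of (current x P)) (u @ y # v) Ps) else 0)"
  proof (cases "length u + Suc (length v) = length Ps")
    case True
    define Qs Rs where "Qs = take (length u) Ps" and "Rs = drop (Suc (length u)) Ps"
    define P where "P = Ps ! length u"
    have Ps: "Ps = Qs @ P # Rs" and len: "length u = length Qs"
      using True by (simp_all add: Qs_def P_def Rs_def id_take_nth_drop[symmetric])
    have "complex_linear (\<lambda>y :: 'g. current y P)"
      by (rule complex_linearI) (simp_all add: current_add_left current_scaleC_left)
    from complex_linear_compose[OF complex_linear_envelope_of this]
    have "complex_linear (\<lambda>y :: 'g. a * envelope_of (current y P) * b)" for a b
      by (rule complex_linear_mult_fun)
    then show ?thesis
      using True by (simp add: Ps len mult.assoc[symmetric])
  qed (simp add: complex_linear_zero_fun)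
qed

lemma tensor_eval_pure:
  "length w = length Ps \<Longrightarrow>
    tensor_eval (pure_tensor w) Ps = prod_list (map2 (\<lambda>x P. envelope_of (current x P)) w Ps)"
  unfolding tensor_eval_def by (simp add: tensor_lift_pure[OF multilinear_tensor_eval])

lemma complex_linear_tensor_eval: "complex_linear (\<lambda>\<theta>. tensor_eval \<theta> Ps)"
  unfolding tensor_eval_def by (rule complex_linear_tensor_lift[OF multilinear_tensor_eval])

text \<open>\<open>\<theta>(n\<^sub>1, \<dots>, n\<^sub>k) = \<theta>(t^n\<^sub>1, \<dots>, t^n\<^sub>k)\<close>\<close>

definition tensor_eval_nat ::
    "'g::complex_lie_algebra tensor_algebra \<Rightarrow> nat list \<Rightarrow> 'g poly enveloping_algebra"
  where "tensor_eval_nat \<theta> ns = tensor_eval \<theta> (map (monom 1) ns)"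

end

(* Write L = g[t] and let Q be the span of the powers x^n (x in L) in T(L), i.e. the symmetric
   tensors. By polarization Q maps onto U(L), and it does so injectively: since g is reductive,
   the adjoint representation and the characters separate the points of L, so every linear
   functional on L extends to one on U(L) vanishing at 1, and convolution products of such
   extensions recover the top degree part of an element of Q from its image in U(L). As Q is stable
   under g, every invariant of U(L) lifts to an invariant s in Q, and complete reducibility of
   tensor powers is not needed. The components of s in g t^n1 (x) ... (x) g t^nk are invariants
   theta of T(g), and the lifted element is the sum of the theta(n1, ..., nk). Because s is
   symmetric, sorting the exponents changes this sum only by an invariant of lower filtration
   degree, and induction on the degree shows that the theta(n1, ..., nk) with sorted exponents
   span. Both claims follow, as theta(n1, ..., nk) is linear in theta and a product theta theta' is
   evaluated by splitting the (still sorted) list of exponents. *)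

theory Submission
  imports Defs
begin

section \<open>Linear algebra\<close>

text \<open>Q is spanned by powers of single elements, so no symmetric group acts anywhere: a claim
  about symmetric tensors is tested on one power x^n, and polarization brings the sums with one
  letter changed, which brackets produce, back into the span of powers. The obstacle is the
  injectivity of Q into U(L), a weak form of Poincare-Birkhoff-Witt. It is reduced to a question
  about L alone: do linear functionals on U(L) vanishing at 1 separate the points of L? The adjoint
  representation answers it only modulo the center of g[t]. The characters p |-> h(coeff p n), with
  h zero on [g, g], deal with the center, because for reductive g the center meets [g, g] in 0. Word
  length is tracked alongside, since the induction that sorts exponents needs a lift within the same
  degree bound as the invariant itself.\<close>

lemma functional_extension:
  fixes f :: "'a::complex_vector \<Rightarrow> complex"
  assumes "cvec.independent B"
  obtains h where "complex_linear h" "\<And>b. b \<in> B \<Longrightarrow> h b = f b"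
proof -
  interpret vector_space_pair "scaleC :: complex \<Rightarrow> 'a \<Rightarrow> 'a" "scaleC :: complex \<Rightarrow> complex \<Rightarrow> complex"
    by unfold_locales
  from linear_independent_extend[OF assms, of f] show ?thesis
    using that by (auto simp: complex_linear_def)
qed

lemma separating_functional:
  fixes a :: "'a::complex_vector"
  assumes "a \<notin> cvec.span D"
  obtains h :: "'a \<Rightarrow> complex" where "complex_linear h" "\<And>d. d \<in> D \<Longrightarrow> h d = 0" "h a = 1"
proof -
  obtain B where B: "B \<subseteq> D" "cvec.independent B" "D \<subseteq> cvec.span B"
    using cvec.maximal_independent_subset[of D] by blast
  have eq: "cvec.span B = cvec.span D"
    using B by (metis cvec.span_mono cvec.span_span subset_antisym)
  have "cvec.independent (insert a B)"
    using assms B(2) eq by (simp add: cvec.independent_insertI)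
  then obtain h :: "'a \<Rightarrow> complex" where h: "complex_linear h"
    "\<And>b. b \<in> insert a B \<Longrightarrow> h b = (if b = a then 1 else 0)"
    using functional_extension[of "insert a B" "\<lambda>b. if b = a then 1 else 0"] by metis
  have ab: "a \<notin> B" using assms B(1) cvec.span_base by blast
  have "h d = 0" if "d \<in> D" for d
  proof -
    have "d \<in> cvec.span B" using that B(3) by blast
    then show ?thesis
    proof (induction rule: cvec.span_induct_alt)
      case base show ?case by (rule complex_linear_zero[OF h(1)])
    next
      case (step c x y)
      then show ?case
        using h(2)[of x] ab
        by (auto simp: complex_linear_add[OF h(1)] complex_linear_scaleC[OF h(1)])
    qed
  qed
  then show ?thesis using that h by auto
qed

lemma complex_linear_span:
  assumes "complex_linear f" "x \<in> cvec.span S" "\<And>s. s \<in> S \<Longrightarrow> f s \<in> cvec.span R"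
  shows "f x \<in> cvec.span R"
  using assms(2)
proof (induction rule: cvec.span_induct_alt)
  case base then show ?case by (simp add: complex_linear_zero[OF assms(1)] cvec.span_zero)
next
  case (step c x y) then show ?case
    by (simp add: complex_linear_add[OF assms(1)] complex_linear_scaleC[OF assms(1)]
        assms(3) cvec.span_add cvec.span_scale)
qed

lemma complex_linear_eq_on_span:
  assumes "complex_linear f" "complex_linear g" "x \<in> cvec.span S" "\<And>s. s \<in> S \<Longrightarrow> f s = g s"
  shows "f x = g x"
  using assms(3)
proof (induction rule: cvec.span_induct_alt)
  case base then show ?case by (simp add: complex_linear_zero assms(1,2))
next
  case (step c x y) then show ?case
    by (simp add: complex_linear_add complex_linear_scaleC assms(1,2,4))
qed

text \<open>Duality makes \<open>v\<close> injective on \<open>I\<close>, so \<open>F i\<close>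
  reads off the coefficient of \<open>v i\<close> in any finite combination.\<close>

lemma dual_family_separates:
  fixes F :: "'i \<Rightarrow> 'a::complex_vector \<Rightarrow> complex"
  assumes lin: "\<And>i. i \<in> I \<Longrightarrow> complex_linear (F i)"
    and dual: "\<And>i j. i \<in> I \<Longrightarrow> j \<in> I \<Longrightarrow> F i (v j) = (if i = j then 1 else 0)"
    and t: "t \<in> cvec.span (v ` I)" and zero: "\<And>i. i \<in> I \<Longrightarrow> F i t = 0"
  shows "t = 0"
proof -
  obtain A r where A: "finite A" "A \<subseteq> v ` I" and tA: "t = (\<Sum>a\<in>A. r a *\<^sub>C a)"
    using t unfolding cvec.span_explicit by blast
  have "r a = 0" if a: "a \<in> A" for a
  proof -
    obtain i where i: "i \<in> I" "a = v i" using A(2) a by blast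
    have "0 = F i t" using zero[OF i(1)] by simp
    also have "\<dots> = (\<Sum>b\<in>A. r b *\<^sub>C F i b)"
      by (simp add: tA complex_linear_sum[OF lin[OF i(1)]] complex_linear_scaleC[OF lin[OF i(1)]])
    also have "\<dots> = (\<Sum>b\<in>A. if b = a then r a else 0)"
    proof (rule sum.cong[OF refl])
      fix b assume "b \<in> A"
      then obtain j where j: "j \<in> I" "b = v j" using A(2) by blast
      have "F i b = (if b = a then 1 else 0)"
        using dual[OF i(1) j(1)] dual[OF i(1) i(1)] i(2) j(2) by auto
      then show "r b *\<^sub>C F i b = (if b = a then r a else 0)"
        by (simp add: scaleC_complex_def)
    qed
    also have "\<dots> = r a" using A(1) a by simp
    finally show ?thesis by simp
  qed
  then show ?thesis by (simp add: tA)
qed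

section \<open>Polarization of powers\<close>

text \<open>A Vandermonde argument without determinants: if p(t) lies in \<open>W\<close> for all t,
  so does p(2t) - 2^(n+1) p(t). This kills the coefficient of degree n + 1 and multiplies the one of
  degree k \<le> n by 2^k - 2^(n+1), which is nonzero.\<close>

lemma polynomial_coefficients_in_subspace:
  fixes v :: "nat \<Rightarrow> 'a::complex_vector"
  assumes W: "cvec.subspace W" and "\<And>t. (\<Sum>k\<le>n. t ^ k *\<^sub>C v k) \<in> W" and "k \<le> n"
  shows "v k \<in> W"
  using assms(2,3)
proof (induction n arbitrary: v k)
  case 0
  then show ?case using "0.prems"(1)[of 1] by (simp add: scaleC_one)
next
  case (Suc n)
  have low: "v k \<in> W" if k: "k \<le> n" for k
  proof -
    define c where "c k = (2 ^ k - 2 ^ Suc n :: complex)" for k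
    have "(\<Sum>k\<le>n. t ^ k *\<^sub>C c k *\<^sub>C v k) \<in> W" for t
    proof -
      have "(\<Sum>k\<le>n. t ^ k *\<^sub>C c k *\<^sub>C v k) = (\<Sum>k\<le>Suc n. t ^ k *\<^sub>C c k *\<^sub>C v k)"
        by (simp add: c_def)
      also have "\<dots> = (\<Sum>k\<le>Suc n. (2 * t) ^ k *\<^sub>C v k) - 2 ^ Suc n *\<^sub>C (\<Sum>k\<le>Suc n. t ^ k *\<^sub>C v k)"
        unfolding cvec.scale_sum_right sum_subtractf[symmetric] scaleC_scaleC
          cvec.scale_left_diff_distrib[symmetric] c_def power_mult_distrib
        by (simp add: algebra_simps)
      also have "\<dots> \<in> W"
        by (intro cvec.subspace_diff[OF W] cvec.subspace_scale[OF W] Suc.prems)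
      finally show ?thesis .
    qed
    from Suc.IH[OF this k] have "inverse (c k) *\<^sub>C c k *\<^sub>C v k \<in> W"
      by (rule cvec.subspace_scale[OF W])
    moreover have "c k \<noteq> 0"
    proof
      assume "c k = 0"
      then have "of_nat (2 ^ k) = (of_nat (2 ^ Suc n) :: complex)" by (simp add: c_def)
      then have "(2::nat) ^ k = 2 ^ Suc n" by (rule of_nat_eq_iff[THEN iffD1])
      then have "k = Suc n" using power_inject_exp[of "2::nat" k "Suc n"] by simp
      with k show False by simp
    qed
    ultimately show ?thesis by (simp add: scaleC_scaleC scaleC_one)
  qed
  have "(\<Sum>k\<le>Suc n. 1 ^ k *\<^sub>C v k) - (\<Sum>k\<le>n. v k) \<in> W"
    by (intro cvec.subspace_diff[OF W] cvec.subspace_sum[OF W] Suc.prems low) simp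
  then have "v (Suc n) \<in> W" by (simp add: scaleC_one)
  with low Suc.prems(2) show ?case by (cases "k = Suc n") auto
qed

text \<open>Here \<open>x\<close> and \<open>y\<close> need not commute. Only the coefficient
  \<open>v 1\<close> is wanted later; \<open>v 0\<close> and the vanishing beyond \<open>n\<close>
  are carried along because the recursion v'(k) = x v(k) + y v(k - 1), obtained by splitting off a
  left factor x + t y, uses them.\<close>

lemma power_add_scaleC_expansion:
  fixes x y :: "'a::complex_algebra_1"
  shows "\<exists>v. v 0 = x ^ n \<and> v 1 = (\<Sum>i<n. x ^ i * y * x ^ (n - Suc i)) \<and> (\<forall>k>n. v k = 0) \<and>
    (\<forall>t. (x + t *\<^sub>C y) ^ n = (\<Sum>k\<le>n. t ^ k *\<^sub>C v k))"
proof (induction n)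
  case 0
  show ?case by (rule exI[of _ "\<lambda>k. if k = 0 then 1 else 0"]) (simp add: scaleC_one)
next
  case (Suc n)
  then obtain v where v: "v 0 = x ^ n" "v 1 = (\<Sum>i<n. x ^ i * y * x ^ (n - Suc i))"
    "\<And>k. k > n \<Longrightarrow> v k = 0" "\<And>t. (x + t *\<^sub>C y) ^ n = (\<Sum>k\<le>n. t ^ k *\<^sub>C v k)" by blast
  define v' where "v' k = x * v k + (case k of 0 \<Rightarrow> 0 | Suc j \<Rightarrow> y * v j)" for k
  have "(x + t *\<^sub>C y) ^ Suc n = (\<Sum>k\<le>Suc n. t ^ k *\<^sub>C v' k)" for t
  proof -
    have "(x + t *\<^sub>C y) ^ Suc n = (\<Sum>k\<le>n. t ^ k *\<^sub>C (x * v k)) + (\<Sum>k\<le>n. t ^ Suc k *\<^sub>C (y * v k))"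
      by (simp add: v(4) distrib_right sum_distrib_left mult_scaleC_left mult_scaleC_right
          scaleC_scaleC cvec.scale_sum_right mult.commute scaleC_add_right sum.distrib)
    also have "(\<Sum>k\<le>n. t ^ k *\<^sub>C (x * v k)) = (\<Sum>k\<le>Suc n. t ^ k *\<^sub>C (x * v k))"
      by (simp add: v(3))
    also have "(\<Sum>k\<le>n. t ^ Suc k *\<^sub>C (y * v k)) =
        (\<Sum>k\<le>Suc n. t ^ k *\<^sub>C (case k of 0 \<Rightarrow> 0 | Suc j \<Rightarrow> y * v j))"
      by (subst sum.atMost_Suc_shift) simp
    finally show ?thesis
      by (simp only: v'_def scaleC_add_right sum.distrib)
  qed
  moreover have "v' 1 = (\<Sum>i<Suc n. x ^ i * y * x ^ (Suc n - Suc i))"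
    unfolding sum.lessThan_Suc_shift
    using v(1,2) by (simp add: v'_def sum_distrib_left mult.assoc add.commute)
  ultimately show ?case
    using v(1,3) by (intro exI[of _ v']) (auto simp: v'_def split: nat.split)
qed

text \<open>The sum is the coefficient of t in (x + t y)^(n+1), the derivative of that power at t =
  0.\<close>

lemma polarization:
  fixes x y :: "'a::complex_algebra_1"
  shows "(\<Sum>i\<le>n. x ^ i * y * x ^ (n - i)) \<in> cvec.span {(x + t *\<^sub>C y) ^ Suc n | t. True}"
    (is "_ \<in> ?W")
proof -
  obtain v where v: "v 1 = (\<Sum>i<Suc n. x ^ i * y * x ^ (Suc n - Suc i))"
    "\<And>t. (x + t *\<^sub>C y) ^ Suc n = (\<Sum>k\<le>Suc n. t ^ k *\<^sub>C v k)"
    using power_add_scaleC_expansion[where n = "Suc n" and x = x and y = y] by blast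
  have "(\<Sum>k\<le>Suc n. t ^ k *\<^sub>C v k) \<in> ?W" for t
    unfolding v(2)[symmetric] by (rule cvec.span_base) blast
  then have "v 1 \<in> ?W"
    by (rule polynomial_coefficients_in_subspace[OF cvec.subspace_span]) simp
  then show ?thesis unfolding v(1) by (simp add: lessThan_Suc_atMost)
qed

section \<open>Tensor and enveloping algebras\<close>

lemma pure_tensor_Nil [simp]: "pure_tensor [] = 1"
  by (simp add: pure_tensor_def)

lemma pure_tensor_Cons [simp]: "pure_tensor (x # w) = tensor_of x * pure_tensor w"
  by (simp add: pure_tensor_def)

lemma pure_tensor_replicate: "pure_tensor (replicate n x) = tensor_of x ^ n"
  by (simp add: pure_tensor_def map_replicate_const)

lemma span_pure_tensor: "cvec.span (range pure_tensor) = UNIV"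
proof -
  have "\<theta> \<in> cvec.span (range pure_tensor)" for \<theta> :: "'a tensor_algebra"
  proof (induction \<theta> rule: tensor_algebra.abs_induct)
    case (1 p)
    have lin: "complex_linear (abs_tensor_algebra :: 'a free_algebra \<Rightarrow> _)"
      by (rule complex_linearI) (simp_all add: plus_tensor_algebra.abs_eq scaleC_tensor_algebra.abs_eq)
    have pure: "\<exists>w. abs_tensor_algebra (Poly_Mapping.single k 1) = pure_tensor w" for k :: "'a free_monoid"
      by (cases k) (auto simp: abs_single)
    have "abs_tensor_algebra p \<in> cvec.span (range pure_tensor)"
      by (subst free_algebra_expand)
        (simp only: complex_linear_sum[OF lin] complex_linear_scaleC[OF lin],
          intro cvec.span_sum cvec.span_scale cvec.span_base, use pure in blast)
    then show ?case .
  qed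
  then show ?thesis by blast
qed

text \<open>Lets identities on T(V) be checked by prefixing one letter at a time, which fits maps
  given by a rule for \<open>tensor_of x * \<theta>\<close>.\<close>

lemma tensor_algebra_induct [case_names one mult add scale]:
  assumes one: "P 1" and mult: "\<And>x \<theta>. P \<theta> \<Longrightarrow> P (tensor_of x * \<theta>)"
    and add: "\<And>a b. P a \<Longrightarrow> P b \<Longrightarrow> P (a + b)" and scale: "\<And>c a. P a \<Longrightarrow> P (c *\<^sub>C a)"
  shows "P \<theta>"
proof -
  have pure: "P (pure_tensor w)" for w
    by (induction w) (simp_all add: one mult)
  have "\<theta> \<in> cvec.span (range pure_tensor)" by (simp add: span_pure_tensor)
  then show ?thesis
  proof (induction rule: cvec.span_induct_alt)
    case base
    \<comment> \<open>The induction rule has no case for zero, since zero is 0 times the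
      unit.\<close>
    show ?case using scale[OF one, of 0] by simp
  next
    case (step c x y)
    then show ?case by (auto intro: add scale pure)
  qed
qed

lemma complex_linear_eq_on_pure:
  assumes "complex_linear f" "complex_linear g" "\<And>w. f (pure_tensor w) = g (pure_tensor w)"
  shows "f \<theta> = g \<theta>"
  by (rule complex_linear_eq_on_span[OF assms(1,2), of _ "range pure_tensor"])
    (auto simp: span_pure_tensor assms(3))

lemma complex_linear_mult_left: "complex_linear (\<lambda>x :: 'a::complex_algebra_1. a * x)"
  by (rule complex_linearI) (simp_all add: distrib_left mult_scaleC_right)

lemma complex_linear_mult_right: "complex_linear (\<lambda>x :: 'a::complex_algebra_1. x * a)"
  by (rule complex_linearI) (simp_all add: distrib_right mult_scaleC_left)

lemma complex_linear_add_fun: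
  "complex_linear f \<Longrightarrow> complex_linear g \<Longrightarrow> complex_linear (\<lambda>x. f x + g x)"
  by (rule complex_linearI) (simp_all add: complex_linear_add complex_linear_scaleC scaleC_add_right)

lemma complex_linear_diff_fun:
  "complex_linear f \<Longrightarrow> complex_linear g \<Longrightarrow> complex_linear (\<lambda>x. f x - g x)"
  by (rule complex_linearI)
    (simp_all add: complex_linear_add complex_linear_scaleC cvec.scale_right_diff_distrib)

lemma complex_linear_scale_fun:
  "complex_linear f \<Longrightarrow> complex_linear (\<lambda>x. c *\<^sub>C f x)"
  by (rule complex_linearI)
    (simp_all add: complex_linear_add complex_linear_scaleC scaleC_add_right scaleC_scaleC mult.commute)

lemma multilinear_Cons:
  assumes "multilinear f" shows "multilinear (\<lambda>w. f (x # w))"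
  by (rule multilinearI) (use multilinearD[OF assms, of "x # _"] in simp)

lemma tensor_lift_one: "multilinear f \<Longrightarrow> tensor_lift f 1 = f []"
  using tensor_lift_pure[of f "[]"] by simp

lemma tensor_lift_mult:
  assumes "multilinear f"
  shows "tensor_lift f (tensor_of x * \<theta>) = tensor_lift (\<lambda>w. f (x # w)) \<theta>"
proof (rule complex_linear_eq_on_pure[where \<theta> = \<theta>])
  show "complex_linear (\<lambda>\<theta>. tensor_lift f (tensor_of x * \<theta>))"
    by (rule complex_linear_compose[OF complex_linear_tensor_lift[OF assms] complex_linear_mult_left])
  show "complex_linear (tensor_lift (\<lambda>w. f (x # w)))"
    by (rule complex_linear_tensor_lift[OF multilinear_Cons[OF assms]])
  show "tensor_lift f (tensor_of x * pure_tensor w) = tensor_lift (\<lambda>w. f (x # w)) (pure_tensor w)" for w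
    using tensor_lift_pure[OF assms, of "x # w"] tensor_lift_pure[OF multilinear_Cons[OF assms], of x w]
    by simp
qed

lemma tensor_ad_one: "tensor_ad x 1 = 0"
  unfolding tensor_ad_def by (simp add: tensor_lift_one[OF multilinear_tensor_ad])

lemma tensor_ad_mult:
  "tensor_ad x (tensor_of y * \<theta>) = tensor_of (lie_bracket x y) * \<theta> + tensor_of y * tensor_ad x \<theta>"
proof (rule complex_linear_eq_on_pure[where \<theta> = \<theta>])
  show "complex_linear (\<lambda>\<theta>. tensor_ad x (tensor_of y * \<theta>))"
    by (rule complex_linear_compose[OF complex_linear_tensor_ad complex_linear_mult_left])
  show "complex_linear (\<lambda>\<theta>. tensor_of (lie_bracket x y) * \<theta> + tensor_of y * tensor_ad x \<theta>)"
    by (rule complex_linear_add_fun[OF complex_linear_mult_left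
        complex_linear_compose[OF complex_linear_mult_left complex_linear_tensor_ad]])
  fix w
  have "tensor_ad x (pure_tensor (y # w)) =
      tensor_of (lie_bracket x y) * pure_tensor w + tensor_of y * tensor_ad x (pure_tensor w)"
    unfolding tensor_ad_pure
    by (simp add: sum.lessThan_Suc_shift sum_distrib_left del: sum.lessThan_Suc)
  then show "tensor_ad x (tensor_of y * pure_tensor w) =
      tensor_of (lie_bracket x y) * pure_tensor w + tensor_of y * tensor_ad x (pure_tensor w)"
    by simp
qed

text \<open>Leibniz rule. The right-hand side is the sum that \<open>polarization\<close>, applied
  to \<open>tensor_of x\<close> and \<open>tensor_of (lie_bracket y x)\<close>, places in the span
  of powers, so that span is stable under \<open>tensor_ad\<close>.\<close>

lemma tensor_ad_power:
  "tensor_ad y (tensor_of x ^ n) =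
    (\<Sum>i<n. tensor_of x ^ i * tensor_of (lie_bracket y x) * tensor_of x ^ (n - Suc i))"
proof (induction n)
  case (Suc n)
  then show ?case
    by (simp add: tensor_ad_mult sum.lessThan_Suc_shift sum_distrib_left mult.assoc
        del: sum.lessThan_Suc)
qed (simp add: tensor_ad_one)

text \<open>The projection \<open>abs_enveloping_algebra\<close> is the algebra homomorphism \<open>T(L) \<rightarrow> U(L)\<close>.\<close>

lemma envelope_simps:
  shows envelope_one: "abs_enveloping_algebra 1 = 1"
    and envelope_add: "abs_enveloping_algebra (a + b) = abs_enveloping_algebra a + abs_enveloping_algebra b"
    and envelope_mult: "abs_enveloping_algebra (a * b) = abs_enveloping_algebra a * abs_enveloping_algebra b"
    and envelope_scaleC: "abs_enveloping_algebra (c *\<^sub>C a) = c *\<^sub>C abs_enveloping_algebra a"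
    and envelope_tensor_of: "abs_enveloping_algebra (tensor_of x) = envelope_of x"
  by (simp_all add: one_enveloping_algebra.abs_eq plus_enveloping_algebra.abs_eq
      times_enveloping_algebra.abs_eq scaleC_enveloping_algebra.abs_eq envelope_of.abs_eq)

lemma complex_linear_envelope: "complex_linear abs_enveloping_algebra"
  by (rule complex_linearI) (simp_all add: envelope_simps)

lemma envelope_power: "abs_enveloping_algebra (a ^ n) = abs_enveloping_algebra a ^ n"
  by (induction n) (simp_all add: envelope_simps)

lemma envelope_eq_0_iff:
  "abs_enveloping_algebra p = 0 \<longleftrightarrow> p \<in> ideal_hull enveloping_relations"
  unfolding zero_enveloping_algebra_def by (simp add: enveloping_algebra.abs_eq_iff)

abbreviation envelope_word :: "'g::complex_lie_algebra list \<Rightarrow> 'g enveloping_algebra"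
  where "envelope_word w \<equiv> prod_list (map envelope_of w)"

lemma envelope_pure: "abs_enveloping_algebra (pure_tensor w) = envelope_word w"
  by (induction w) (simp_all add: envelope_simps)

lemma span_envelope_word: "u \<in> cvec.span (range envelope_word)"
proof -
  obtain p where p: "u = abs_enveloping_algebra p"
    by (induction u rule: enveloping_algebra.abs_induct) blast
  show ?thesis unfolding p
    by (rule complex_linear_span[OF complex_linear_envelope, of _ "range pure_tensor"])
      (auto simp: span_pure_tensor envelope_pure intro: cvec.span_base)
qed

text \<open>Both sides obey the Leibniz rule in \<open>s\<close>, and on letters they agree by the
  defining relation of U(L).\<close>

lemma envelope_tensor_ad:
  "abs_enveloping_algebra (tensor_ad y s) =
    envelope_of y * abs_enveloping_algebra s - abs_enveloping_algebra s * envelope_of y"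
proof (induction s rule: tensor_algebra_induct)
  case one
  show ?case by (simp add: tensor_ad_one envelope_one complex_linear_zero[OF complex_linear_envelope])
next
  case (mult x s)
  have "envelope_of x * (abs_enveloping_algebra (tensor_ad y s) + abs_enveloping_algebra s * envelope_of y)
      = envelope_of x * (envelope_of y * abs_enveloping_algebra s)"
    by (simp add: mult.IH)
  then show ?case
    by (simp add: tensor_ad_mult envelope_simps envelope_of_commutator[symmetric] algebra_simps)
next
  case (add a b)
  then show ?case
    by (simp add: complex_linear_add[OF complex_linear_tensor_ad] envelope_simps algebra_simps)
next
  case (scale c a)
  then show ?case
    by (simp add: complex_linear_scaleC[OF complex_linear_tensor_ad] envelope_simps
        mult_scaleC_left mult_scaleC_right cvec.scale_right_diff_distrib)
qed

section \<open>The filtration of the enveloping algebra\<close>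

text \<open>Shifted by one against the usual degree filtration: the bound is strict, so level 0 is
  the zero space and can start inductions, and membership in level \<open>length w\<close> means
  lower degree than \<open>w\<close>.\<close>

definition envelope_filtration :: "nat \<Rightarrow> 'g::complex_lie_algebra enveloping_algebra set"
  where "envelope_filtration n = cvec.span {envelope_word w | w. length w < n}"

lemma subspace_envelope_filtration: "cvec.subspace (envelope_filtration n)"
  by (simp add: envelope_filtration_def)

lemma envelope_word_in_filtration: "length w < n \<Longrightarrow> envelope_word w \<in> envelope_filtration n"
  unfolding envelope_filtration_def by (rule cvec.span_base) blast

lemma envelope_filtration_mono: "m \<le> n \<Longrightarrow> envelope_filtration m \<subseteq> envelope_filtration n"
  unfolding envelope_filtration_def by (rule cvec.span_mono) auto

lemma envelope_filtration_mult_left: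
  fixes u :: "'g::complex_lie_algebra enveloping_algebra"
  assumes "u \<in> envelope_filtration n"
  shows "envelope_word w * u \<in> envelope_filtration (length w + n)"
  using assms unfolding envelope_filtration_def
proof (rule complex_linear_span[OF complex_linear_mult_left])
  fix s :: "'g enveloping_algebra" assume "s \<in> {envelope_word v | v. length v < n}"
  then obtain v where "s = envelope_word v" "length v < n" by blast
  then have "envelope_word w * s = envelope_word (w @ v)" "length (w @ v) < length w + n" by simp_all
  then show "envelope_word w * s \<in> cvec.span {envelope_word v | v. length v < length w + n}"
    by (metis (mono_tags, lifting) cvec.span_base mem_Collect_eq)
qed

lemma envelope_filtration_mult_right:
  fixes u :: "'g::complex_lie_algebra enveloping_algebra"
  assumes "u \<in> envelope_filtration n"
  shows "u * envelope_word w \<in> envelope_filtration (n + length w)"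
  using assms unfolding envelope_filtration_def
proof (rule complex_linear_span[OF complex_linear_mult_right])
  fix s :: "'g enveloping_algebra" assume "s \<in> {envelope_word v | v. length v < n}"
  then obtain v where "s = envelope_word v" "length v < n" by blast
  then have "s * envelope_word w = envelope_word (v @ w)" "length (v @ w) < n + length w" by simp_all
  then show "s * envelope_word w \<in> cvec.span {envelope_word v | v. length v < n + length w}"
    by (metis (mono_tags, lifting) cvec.span_base mem_Collect_eq)
qed

text \<open>Each product has one letter more than \<open>w\<close>, but their difference is the sum
  of the words obtained from \<open>w\<close> by replacing one letter x by [a, x].\<close>

lemma envelope_commutator_in_filtration:
  "envelope_of a * envelope_word w - envelope_word w * envelope_of a \<in> envelope_filtration (Suc (length w))"
proof (induction w)
  case Nil
  show ?case by (simp add: cvec.subspace_0[OF subspace_envelope_filtration])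
next
  case (Cons x w)
  have "envelope_of a * envelope_word (x # w) - envelope_word (x # w) * envelope_of a =
      envelope_word (lie_bracket a x # w) +
      envelope_word [x] * (envelope_of a * envelope_word w - envelope_word w * envelope_of a)"
    by (simp add: envelope_of_commutator[symmetric] algebra_simps)
  also have "\<dots> \<in> envelope_filtration (Suc (length (x # w)))"
    using envelope_filtration_mult_left[OF Cons.IH, of "[x]"]
    by (intro cvec.subspace_add[OF subspace_envelope_filtration] envelope_word_in_filtration) simp_all
  finally show ?case .
qed

text \<open>Commutativity of the associated graded algebra. If \<open>w = p @ a # q\<close>, the
  induction hypothesis compares the rest of \<open>v\<close> with \<open>p @ q\<close>, and moving
  \<open>a\<close> past \<open>p\<close> leaves a commutator of lower degree.\<close>

lemma envelope_word_permute:
  assumes "mset v = mset w"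
  shows "envelope_word v - envelope_word w \<in> envelope_filtration (length w)"
  using assms
proof (induction v arbitrary: w)
  case Nil
  then show ?case by (simp add: cvec.subspace_0[OF subspace_envelope_filtration])
next
  case (Cons a v)
  then have "a \<in> set w" by (metis list.set_intros(1) set_mset_mset)
  then obtain p q where w: "w = p @ a # q" by (meson split_list)
  with Cons.prems have "mset v = mset (p @ q)" by simp
  from Cons.IH[OF this]
  have "envelope_word [a] * (envelope_word v - envelope_word (p @ q)) \<in> envelope_filtration (length w)"
    using envelope_filtration_mult_left[of _ "length (p @ q)" "[a]"] w by simp
  moreover have "(envelope_of a * envelope_word p - envelope_word p * envelope_of a) * envelope_word q
      \<in> envelope_filtration (length w)"
    using envelope_filtration_mult_right[OF envelope_commutator_in_filtration, of a p q] w by simp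
  ultimately have "envelope_word [a] * (envelope_word v - envelope_word (p @ q)) +
      (envelope_of a * envelope_word p - envelope_word p * envelope_of a) * envelope_word q
      \<in> envelope_filtration (length w)"
    by (rule cvec.subspace_add[OF subspace_envelope_filtration])
  moreover have "envelope_word [a] * (envelope_word v - envelope_word (p @ q)) +
      (envelope_of a * envelope_word p - envelope_word p * envelope_of a) * envelope_word q =
      envelope_word (a # v) - envelope_word w"
    by (simp add: w algebra_simps)
  ultimately show ?case by simp
qed

text \<open>Symmetrization is onto, with control of the degree. Modulo lower degree, y x^k is the
  average of the products x^i y x^(k-i), and polarization writes their sum in (k+1)-st
  powers.\<close>

lemma envelope_filtration_subset_span_powers:
  "envelope_filtration n \<subseteq> cvec.span {envelope_of (x::'g::complex_lie_algebra) ^ k | x k. k < n}"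
    (is "_ \<subseteq> ?P n")
proof (induction n)
  case 0
  show ?case by (simp add: envelope_filtration_def)
next
  case (Suc n)
  have mono: "?P n \<subseteq> ?P (Suc n)" by (rule cvec.span_mono) (blast intro: less_SucI)
  have step: "envelope_of y * envelope_of x ^ k \<in> ?P (Suc n)" if k: "k < n" for x y :: 'g and k
  proof -
    have "(envelope_of y * envelope_of x ^ i - envelope_of x ^ i * envelope_of y) * envelope_of x ^ (k - i)
        \<in> ?P (Suc n)" if "i \<le> k" for i
    proof -
      \<comment> \<open>The commutator is a sum of words of length at most i, so the product has
        level k + 1 \<le> n and the outer induction hypothesis applies.\<close>
      have "(envelope_of y * envelope_of x ^ i - envelope_of x ^ i * envelope_of y) * envelope_of x ^ (k - i)
          \<in> envelope_filtration (Suc i + (k - i))"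
        using envelope_filtration_mult_right[OF envelope_commutator_in_filtration,
            of y "replicate i x" "replicate (k - i) x"]
        by (simp add: map_replicate_const)
      also have "\<dots> \<subseteq> ?P (Suc n)"
        using that k Suc.IH mono envelope_filtration_mono[of "Suc i + (k - i)" n] by auto
      finally show ?thesis .
    qed
    then have "(\<Sum>i\<le>k. (envelope_of y * envelope_of x ^ i - envelope_of x ^ i * envelope_of y)
        * envelope_of x ^ (k - i)) \<in> ?P (Suc n)"
      by (intro cvec.span_sum) simp
    moreover have "(\<Sum>i\<le>k. envelope_of x ^ i * envelope_of y * envelope_of x ^ (k - i)) \<in> ?P (Suc n)"
    proof -
      have "{(envelope_of x + t *\<^sub>C envelope_of y) ^ Suc k | t. True} \<subseteq>
          {envelope_of x ^ k | x k. k < Suc n}"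
      proof safe
        fix t
        have "envelope_of x + t *\<^sub>C envelope_of y = envelope_of (x + t *\<^sub>C y)"
          by (simp add: complex_linear_add[OF complex_linear_envelope_of]
              complex_linear_scaleC[OF complex_linear_envelope_of])
        then show "\<exists>x' k'. (envelope_of x + t *\<^sub>C envelope_of y) ^ Suc k = envelope_of x' ^ k' \<and> k' < Suc n"
          using k by (metis Suc_less_eq)
      qed
      from cvec.span_mono[OF this] polarization[of "envelope_of x" "envelope_of y" k]
      show ?thesis by blast
    qed
    \<comment> \<open>For each i the two summands add up to y x^k, so the total is (k + 1) y x^k; it
      remains to divide by k + 1.\<close>
    ultimately have "(\<Sum>i\<le>k. (envelope_of y * envelope_of x ^ i - envelope_of x ^ i * envelope_of y)
        * envelope_of x ^ (k - i)) +
        (\<Sum>i\<le>k. envelope_of x ^ i * envelope_of y * envelope_of x ^ (k - i)) \<in> ?P (Suc n)"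
      by (rule cvec.span_add)
    also have "(\<Sum>i\<le>k. (envelope_of y * envelope_of x ^ i - envelope_of x ^ i * envelope_of y)
        * envelope_of x ^ (k - i)) +
        (\<Sum>i\<le>k. envelope_of x ^ i * envelope_of y * envelope_of x ^ (k - i)) =
        (\<Sum>i\<le>k. envelope_of y * envelope_of x ^ k)"
      unfolding sum.distrib[symmetric]
      by (rule sum.cong) (simp_all add: left_diff_distrib mult.assoc power_add[symmetric])
    also have "\<dots> = of_nat (Suc k) *\<^sub>C (envelope_of y * envelope_of x ^ k)"
      by (simp only: cvec.sum_constant_scale card_atMost)
    finally have "inverse (of_nat (Suc k)) *\<^sub>C of_nat (Suc k) *\<^sub>C (envelope_of y * envelope_of x ^ k)
        \<in> ?P (Suc n)"
      by (rule cvec.span_scale)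
    moreover have "inverse (of_nat (Suc k)) * of_nat (Suc k) = (1::complex)"
      by (rule left_inverse) (rule of_nat_neq_0)
    ultimately show ?thesis by (simp only: scaleC_scaleC scaleC_one)
  qed
  have "envelope_word w \<in> ?P (Suc n)" if w: "length w < Suc n" for w :: "'g list"
  proof (cases w)
    case Nil
    have "(1 :: 'g enveloping_algebra) = envelope_of 0 ^ 0 \<and> 0 < Suc n" by simp
    then have "(1 :: 'g enveloping_algebra) \<in> {envelope_of x ^ k | x k. k < Suc n}" by blast
    then show ?thesis using Nil by (simp add: cvec.span_base)
  next
    case (Cons y v)
    then have "envelope_word v \<in> ?P n"
      using w subsetD[OF Suc.IH envelope_word_in_filtration[of v]] by simp
    then have "envelope_of y * envelope_word v \<in> ?P (Suc n)"
      by (rule complex_linear_span[OF complex_linear_mult_left]) (auto simp: step)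
    then show ?thesis using Cons by simp
  qed
  then show ?case unfolding envelope_filtration_def
    by (intro cvec.span_minimal) auto
qed

section \<open>Functionals on the enveloping algebra\<close>

text \<open>Linear functionals on \<open>U(L)\<close>, seen as functions of words in \<open>L\<close>.\<close>

definition envelope_functional :: "('g::complex_lie_algebra list \<Rightarrow> complex) \<Rightarrow> bool"
  where "envelope_functional f \<longleftrightarrow> multilinear f \<and>
    (\<forall>u x y v. f (u @ x # y # v) = f (u @ y # x # v) + f (u @ lie_bracket x y # v))"

lemma envelope_functional_Cons:
  assumes "envelope_functional f" shows "envelope_functional (\<lambda>w. f (x # w))"
proof -
  have "f (x # u @ y # z # v) = f (x # u @ z # y # v) + f (x # u @ lie_bracket y z # v)" for u y z v
    using assms unfolding envelope_functional_def by (metis append_Cons)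
  then show ?thesis
    using assms multilinear_Cons unfolding envelope_functional_def by blast
qed

lemma envelope_functional_multilinear: "envelope_functional f \<Longrightarrow> multilinear f"
  by (simp add: envelope_functional_def)

lemma envelope_functional_swap:
  "envelope_functional f \<Longrightarrow> f (x # y # v) = f (y # x # v) + f (lie_bracket x y # v)"
  unfolding envelope_functional_def by (metis append_Nil)

lemma envelope_functional_vanishes_on_relations:
  assumes "envelope_functional f" "r \<in> enveloping_relations"
  shows "tensor_lift f (r * v) = 0"
proof -
  obtain x y where r: "r = tensor_of x * tensor_of y - tensor_of y * tensor_of x - tensor_of (lie_bracket x y)"
    using assms(2) by (auto simp: enveloping_relations_def)
  note m = envelope_functional_multilinear[OF assms(1)]
  note lin = complex_linear_tensor_lift[OF m]
  show ?thesis
  proof (rule complex_linear_eq_on_pure[where f = "\<lambda>v. tensor_lift f (r * v)" and g = "\<lambda>_. 0"])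
    show "complex_linear (\<lambda>v. tensor_lift f (r * v))"
      by (rule complex_linear_compose[OF lin complex_linear_mult_left])
    show "complex_linear (\<lambda>_ :: 'a tensor_algebra. 0 :: complex)" by (rule complex_linear_zero_fun)
    fix w
    have "r * pure_tensor w =
        pure_tensor (x # y # w) - pure_tensor (y # x # w) - pure_tensor (lie_bracket x y # w)"
      by (simp add: r left_diff_distrib mult.assoc)
    then show "tensor_lift f (r * pure_tensor w) = 0"
      using envelope_functional_swap[OF assms(1), of x y w]
      by (simp only: complex_linear_diff[OF lin] tensor_lift_pure[OF m]) simp
  qed
qed

text \<open>Such functions descend to U(L). Left factors of an ideal element are absorbed letter by
  letter on passing from \<open>f\<close> to \<open>\<lambda>w. f (x # w)\<close>, hence the claim
  for all \<open>f\<close> at once; a relation times a right factor remains.\<close>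

lemma envelope_functional_vanishes:
  assumes "envelope_functional f" "abs_enveloping_algebra p = 0"
  shows "tensor_lift f p = 0"
proof -
  have *: "tensor_lift f (u * r * v) = 0"
    if "envelope_functional f" "r \<in> enveloping_relations" for f r u v
    using that(1)
  proof (induction u arbitrary: f rule: tensor_algebra_induct)
    case one
    then show ?case by (simp add: envelope_functional_vanishes_on_relations that(2))
  next
    case (mult x u)
    have "tensor_lift f (tensor_of x * (u * r * v)) = 0"
      unfolding tensor_lift_mult[OF envelope_functional_multilinear[OF mult.prems]]
      by (rule mult.IH[OF envelope_functional_Cons[OF mult.prems]])
    then show ?case by (simp add: mult.assoc)
  next
    case (add a b)
    then show ?case
      using complex_linear_add[OF complex_linear_tensor_lift[OF envelope_functional_multilinear[OF add.prems]]]
      by (simp add: distrib_right)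
  next
    case (scale c a)
    then show ?case
      using complex_linear_scaleC[OF complex_linear_tensor_lift[OF envelope_functional_multilinear[OF scale.prems]]]
      by (simp add: mult_scaleC_left)
  qed
  note lin = complex_linear_tensor_lift[OF envelope_functional_multilinear[OF assms(1)]]
  have "p \<in> ideal_hull enveloping_relations" using assms(2) by (simp add: envelope_eq_0_iff)
  then show ?thesis
  proof induction
    case zero
    show ?case by (rule complex_linear_zero[OF lin])
  next
    case (step r p u v)
    then show ?case by (simp add: complex_linear_add[OF lin] *[OF assms(1)])
  qed
qed

lemma envelope_functional_compose:
  assumes "complex_linear h"
  shows "envelope_functional (\<lambda>w. h (envelope_word w))"
  unfolding envelope_functional_def
proof (intro conjI allI multilinearI)
  fix u v :: "'a list"
  have "complex_linear (\<lambda>x. envelope_word u * envelope_of x * envelope_word v)"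
    by (rule complex_linear_mult_fun[OF complex_linear_envelope_of])
  from complex_linear_compose[OF assms this]
  show "complex_linear (\<lambda>x. h (envelope_word (u @ x # v)))"
    by (simp add: mult.assoc)
  fix x y
  have "envelope_word (u @ x # y # v) =
      envelope_word (u @ y # x # v) + envelope_word (u @ lie_bracket x y # v)"
    by (simp add: envelope_of_commutator[symmetric] algebra_simps)
  then show "h (envelope_word (u @ x # y # v)) =
      h (envelope_word (u @ y # x # v)) + h (envelope_word (u @ lie_bracket x y # v))"
    by (simp only: complex_linear_add[OF assms])
qed

text \<open>The product on \<open>U(L)\<^sup>*\<close> dual to the coproduct for which the elements of \<open>L\<close> are
  primitive.\<close>

fun convolution :: "('a list \<Rightarrow> complex) \<Rightarrow> ('a list \<Rightarrow> complex) \<Rightarrow> 'a list \<Rightarrow> complex"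
  where
    "convolution f g [] = f [] * g []"
  | "convolution f g (x # w) = convolution (\<lambda>v. f (x # v)) g w + convolution f (\<lambda>v. g (x # v)) w"

lemma convolution_add_left:
  "convolution (\<lambda>v. f1 v + f2 v) g w = convolution f1 g w + convolution f2 g w"
  by (induction w arbitrary: f1 f2 g) (simp_all add: algebra_simps)

lemma convolution_add_right:
  "convolution f (\<lambda>v. g1 v + g2 v) w = convolution f g1 w + convolution f g2 w"
  by (induction w arbitrary: g1 g2 f) (simp_all add: algebra_simps)

lemma convolution_scale_left: "convolution (\<lambda>v. c * f v) g w = c * convolution f g w"
  by (induction w arbitrary: f g) (simp_all add: algebra_simps)

lemma convolution_scale_right: "convolution f (\<lambda>v. c * g v) w = c * convolution f g w"
  by (induction w arbitrary: f g) (simp_all add: algebra_simps)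

lemma multilinear_first:
  assumes "multilinear f"
  shows "(\<lambda>v. f ((x + y) # v)) = (\<lambda>v. f (x # v) + f (y # v))"
    and "(\<lambda>v. f ((c *\<^sub>C x) # v)) = (\<lambda>v. c *\<^sub>C f (x # v))"
  using complex_linear_add[OF multilinearD[OF assms, of "[]"]]
    complex_linear_scaleC[OF multilinearD[OF assms, of "[]"]] by simp_all

lemma multilinear_convolution:
  assumes "multilinear f" "multilinear g"
  shows "multilinear (convolution f g)"
proof (rule multilinearI)
  fix u v :: "'a list"
  show "complex_linear (\<lambda>x. convolution f g (u @ x # v))"
    using assms
  proof (induction u arbitrary: f g)
    case Nil
    show ?case
      by (rule complex_linearI)
        (simp_all add: multilinear_first Nil convolution_add_left convolution_add_right
          convolution_scale_left convolution_scale_right scaleC_complex_def algebra_simps)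
  next
    case (Cons y u)
    show ?case
      unfolding append_Cons convolution.simps
      by (intro complex_linear_add_fun Cons.IH multilinear_Cons Cons.prems)
  qed
qed

text \<open>When x and y are distributed over the two factors, the mixed terms are symmetric in x
  and y. Only the terms with both letters in the same factor see the swap, and they contribute the
  bracket.\<close>

lemma envelope_functional_convolution:
  assumes "envelope_functional f" "envelope_functional g"
  shows "envelope_functional (convolution f g)"
proof -
  have "convolution f g (u @ x # y # v) =
      convolution f g (u @ y # x # v) + convolution f g (u @ lie_bracket x y # v)" for u x y v
    using assms
  proof (induction u arbitrary: f g)
    case Nil
    have "(\<lambda>v. f (x # y # v)) = (\<lambda>v. f (y # x # v) + f (lie_bracket x y # v))"
      "(\<lambda>v. g (x # y # v)) = (\<lambda>v. g (y # x # v) + g (lie_bracket x y # v))"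
      using Nil by (simp_all add: envelope_functional_swap[of _ x y])
    then show ?case by (simp add: convolution_add_left convolution_add_right)
  next
    case (Cons z u)
    then show ?case
      using Cons.IH[OF envelope_functional_Cons[OF Cons.prems(1), of z] Cons.prems(2)]
        Cons.IH[OF Cons.prems(1) envelope_functional_Cons[OF Cons.prems(2), of z]] by simp
  qed
  then show ?thesis
    using assms multilinear_convolution unfolding envelope_functional_def by blast
qed

text \<open>A convolution sums over all ways to split the word into two complementary subwords. If
  \<open>g\<close> needs at least \<open>m\<close> letters, a word of length \<open>m\<close> must
  go to \<open>g\<close> entirely.\<close>

lemma convolution_short:
  assumes "\<And>v. length v < m \<Longrightarrow> g v = 0"
  shows "length w < m \<Longrightarrow> convolution f g w = 0"
    and "length w = m \<Longrightarrow> convolution f g w = f [] * g w"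
proof -
  have "(length w < m \<longrightarrow> convolution f g w = 0) \<and> (length w = m \<longrightarrow> convolution f g w = f [] * g w)"
    using assms
  proof (induction w arbitrary: f g m)
    case (Cons x w)
    show ?case
    proof (cases m)
      case (Suc k)
      have "(length w < k \<longrightarrow> convolution f (\<lambda>v. g (x # v)) w = 0) \<and>
          (length w = k \<longrightarrow> convolution f (\<lambda>v. g (x # v)) w = f [] * g (x # w))"
        by (rule Cons.IH) (simp add: Cons.prems Suc)
      moreover have "length w < m \<longrightarrow> convolution (\<lambda>v. f (x # v)) g w = 0"
        using Cons.IH[of m g] Cons.prems by blast
      ultimately show ?thesis using Suc by simp
    qed simp
  qed simp
  then show "length w < m \<Longrightarrow> convolution f g w = 0"
    and "length w = m \<Longrightarrow> convolution f g w = f [] * g w" by blast+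
qed

text \<open>As \<open>f [] = 0\<close> and \<open>g\<close> needs \<open>m\<close> letters, exactly
  one of the m + 1 letters goes to \<open>f\<close>, and it can be chosen in m + 1 ways. Iterating
  this produces the factorial below.\<close>

lemma convolution_replicate:
  assumes "\<And>v. length v < m \<Longrightarrow> g v = 0" "f [] = 0"
  shows "convolution f g (replicate (Suc m) x) = of_nat (Suc m) * f [x] * g (replicate m x)"
  using assms
proof (induction m arbitrary: g)
  case (Suc m)
  have "convolution f (\<lambda>v. g (x # v)) (replicate (Suc m) x) =
      of_nat (Suc m) * f [x] * g (x # replicate m x)"
    by (rule Suc.IH) (simp_all add: Suc.prems)
  moreover have "convolution (\<lambda>v. f (x # v)) g (replicate (Suc m) x) = f [x] * g (replicate (Suc m) x)"
    using convolution_short(2)[of "Suc m" g "replicate (Suc m) x" "\<lambda>v. f (x # v)"] Suc.prems(1)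
    by simp
  ultimately show ?case
    by (simp add: algebra_simps)
qed simp

section \<open>Products of linear maps and the embedding of symmetric tensors\<close>

text \<open>The tensor product of the maps followed by multiplication, set to 0 on words of other
  lengths so that \<open>tensor_lift\<close> applies on all of T(V). Products of functionals,
  \<open>tensor_eval\<close> and \<open>coeff_tensor\<close> are all instances.\<close>

fun product_map :: "('a \<Rightarrow> 'b::complex_algebra_1) list \<Rightarrow> 'a list \<Rightarrow> 'b"
  where
    "product_map [] [] = 1"
  | "product_map (f # fs) (x # w) = f x * product_map fs w"
  | "product_map _ _ = 0"

lemma product_map_length: "length w \<noteq> length fs \<Longrightarrow> product_map fs w = 0"
  by (induction fs w rule: product_map.induct) auto

lemma product_map_map:
  "length w = length ns \<Longrightarrow> product_map (map h ns) w = prod_list (map2 (\<lambda>x n. h n x) w ns)"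
  by (induction w ns rule: list_induct2) auto

lemma multilinear_product_map:
  assumes "\<And>f. f \<in> set fs \<Longrightarrow> complex_linear f"
  shows "multilinear (product_map fs)"
proof (rule multilinearI)
  fix u v :: "'a list"
  show "complex_linear (\<lambda>x. product_map fs (u @ x # v))"
    using assms
  proof (induction u arbitrary: fs)
    case Nil
    show ?case
    proof (cases fs)
      case (Cons f fs')
      then have f: "complex_linear f" using Nil by simp
      show ?thesis
        using complex_linear_compose[OF complex_linear_mult_right f] by (simp add: Cons)
    qed (simp add: complex_linear_zero_fun)
  next
    case (Cons y u)
    show ?case
    proof (cases fs)
      case Nil
      then show ?thesis by (simp add: complex_linear_zero_fun)
    next
      case (Cons f fs')
      have "complex_linear (\<lambda>x. product_map fs' (u @ x # v))"
        using Cons.IH[of fs'] Cons.prems Cons by simp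
      from complex_linear_compose[OF complex_linear_mult_left this] show ?thesis
        by (simp add: Cons)
    qed
  qed
qed

text \<open>Products of coordinate functionals of a basis are dual to the pure tensors of basis
  vectors, and these span T(V).\<close>

lemma product_functionals_separate:
  fixes \<theta> :: "'a::complex_vector tensor_algebra"
  assumes zero: "\<And>fs :: ('a \<Rightarrow> complex) list. (\<And>f. f \<in> set fs \<Longrightarrow> complex_linear f) \<Longrightarrow> tensor_lift (product_map fs) \<theta> = 0"
  shows "\<theta> = 0"
proof -
  obtain B :: "'a set" where B: "cvec.independent B" "cvec.span B = UNIV"
    using cvec.basis_exists[of "UNIV :: 'a set"] by (metis top.extremum_uniqueI)
  define coord where "coord b x = cvec.representation B x b" for b x
  have coord_lin: "complex_linear (coord b)" for b
    by (rule complex_linearI)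
      (simp_all add: coord_def B cvec.representation_add cvec.representation_scale scaleC_complex_def)
  have coord_basis: "coord b c = (if b = c then 1 else 0)" if "c \<in> B" for b c
    using cvec.representation_basis[OF B(1) that] by (auto simp: coord_def)
  have span: "t \<in> cvec.span (pure_tensor ` lists B)" for t
  proof (induction t rule: tensor_algebra_induct)
    case one
    have "pure_tensor [] \<in> pure_tensor ` lists B" by blast
    then show ?case by (simp add: cvec.span_base)
  next
    case (mult x t)
    have base: "tensor_of b * t \<in> cvec.span (pure_tensor ` lists B)" if b: "b \<in> B" for b
    proof (rule complex_linear_span[OF complex_linear_mult_left mult.IH])
      fix s assume "s \<in> pure_tensor ` lists B"
      then obtain w where w: "w \<in> lists B" "s = pure_tensor w" by blast
      have "pure_tensor (b # w) \<in> pure_tensor ` lists B"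
        by (rule imageI) (use w b in simp)
      then show "tensor_of b * s \<in> cvec.span (pure_tensor ` lists B)"
        by (simp add: w cvec.span_base)
    qed
    show ?case
      by (rule complex_linear_span[OF complex_linear_compose[OF complex_linear_mult_right
            complex_linear_tensor_of], of x B]) (simp_all add: B base)
  qed (simp_all add: cvec.span_add cvec.span_scale)
  have dual: "product_map (map coord v) w = (if v = w then 1 else 0)"
    if "v \<in> lists B" "w \<in> lists B" for v w
    using that
  proof (induction v arbitrary: w)
    case Nil
    then show ?case by (cases w) auto
  next
    case (Cons b v)
    then show ?case by (cases w) (auto simp: coord_basis)
  qed
  have m: "multilinear (product_map (map coord v))" for v
    by (rule multilinear_product_map) (auto simp: coord_lin)
  show ?thesis
  proof (rule dual_family_separates[where F = "\<lambda>v. tensor_lift (product_map (map coord v))"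
        and v = pure_tensor and I = "lists B"])
    show "tensor_lift (product_map (map coord v)) \<theta> = 0" for v
      by (rule zero) (auto simp: coord_lin)
  qed (auto simp: span complex_linear_tensor_lift[OF m] tensor_lift_pure[OF m] dual)
qed

text \<open>The form of the Poincare-Birkhoff-Witt theorem used here: the symmetric tensors, i.e. the
  span of the powers of elements of \<open>L\<close>, embed into \<open>U(L)\<close> as soon as \<open>L\<close> embeds into
  \<open>U(L) / \<complex>1\<close>. Functionals \<open>\<phi>\<^sub>i\<close> on \<open>L\<close> then extend to \<open>U(L)\<close>, and their convolution
  \<open>\<phi>\<^sub>1 * \<dots> * \<phi>\<^sub>n\<close> vanishes on \<open>x\<^sup>k\<close> for \<open>k < n\<close> and equals \<open>n! \<phi>\<^sub>1(x) \<dots> \<phi>\<^sub>n(x)\<close> on \<open>x\<^sup>n\<close>.\<close>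

lemma convolution_extends_product:
  assumes ext: "\<And>\<phi> :: 'g::complex_lie_algebra \<Rightarrow> complex. complex_linear \<phi> \<Longrightarrow>
      \<exists>f. envelope_functional f \<and> f [] = 0 \<and> (\<forall>x. f [x] = \<phi> x)"
    and "\<And>\<phi>. \<phi> \<in> set \<phi>s \<Longrightarrow> complex_linear \<phi>"
  shows "\<exists>f :: 'g list \<Rightarrow> complex. envelope_functional f \<and> (\<forall>w. length w < length \<phi>s \<longrightarrow> f w = 0) \<and>
    (\<forall>x. f (replicate (length \<phi>s) x) = fact (length \<phi>s) * product_map \<phi>s (replicate (length \<phi>s) x))"
  using assms(2)
proof (induction \<phi>s)
  case Nil
  have "envelope_functional (\<lambda>w :: 'g list. if w = [] then 1 else 0)"
    by (auto simp: envelope_functional_def complex_linear_zero_fun intro!: multilinearI)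
  then show ?case by (intro exI[of _ "\<lambda>w :: 'g list. if w = [] then 1 else 0"]) simp
next
  case (Cons \<phi> \<phi>s)
  obtain g :: "'g list \<Rightarrow> complex" where g: "envelope_functional g" "\<And>w. length w < length \<phi>s \<Longrightarrow> g w = 0"
    "\<And>x. g (replicate (length \<phi>s) x) = fact (length \<phi>s) * product_map \<phi>s (replicate (length \<phi>s) x)"
    using Cons.IH Cons.prems by force
  obtain f where f: "envelope_functional f" "f [] = 0" "\<And>x. f [x] = \<phi> x"
    using ext[of \<phi>] Cons.prems by auto
  have "convolution f g w = 0" if "length w < length (\<phi> # \<phi>s)" for w
  proof (cases "length w = length \<phi>s")
    case True
    then show ?thesis using convolution_short(2)[of "length \<phi>s" g w f] g(2) f(2) by simp
  next
    case False
    then show ?thesis using convolution_short(1)[of "length \<phi>s" g w f] g(2) that by simp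
  qed
  moreover have "convolution f g (replicate (Suc (length \<phi>s)) x) =
      of_nat (Suc (length \<phi>s)) * f [x] * g (replicate (length \<phi>s) x)" for x
    by (rule convolution_replicate) (simp_all add: g(2) f(2))
  ultimately show ?case
    using envelope_functional_convolution[OF f(1) g(1)]
    by (intro exI[of _ "convolution f g"]) (simp add: f(3) g(3) algebra_simps del: convolution.simps)
qed

text \<open>By separation, 1 and the image of a basis of L are independent in U(L); so a functional
  can be prescribed there as 0 at 1 and \<phi> on the basis, and then extended.\<close>

lemma functional_extends_to_envelope:
  fixes \<phi> :: "'g::complex_lie_algebra \<Rightarrow> complex"
  assumes sep: "\<And>x :: 'g. (\<And>f. envelope_functional f \<Longrightarrow> f [] = 0 \<Longrightarrow> f [x] = 0) \<Longrightarrow> x = 0"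
    and lin: "complex_linear \<phi>"
  shows "\<exists>f. envelope_functional f \<and> f [] = 0 \<and> (\<forall>x. f [x] = \<phi> x)"
proof -
  interpret vector_space_pair "scaleC :: complex \<Rightarrow> 'g \<Rightarrow> 'g"
    "scaleC :: complex \<Rightarrow> 'g enveloping_algebra \<Rightarrow> 'g enveloping_algebra"
    by unfold_locales
  note e = complex_linear_envelope_of
  have L: "Vector_Spaces.linear scaleC scaleC (envelope_of :: 'g \<Rightarrow> _)"
    using e by (simp add: complex_linear_def)
  \<comment> \<open>Used twice: c = 0 gives injectivity of \<open>envelope_of\<close>, and c = 1
    keeps the unit out of its image.\<close>
  have scalar: "x = 0" if "envelope_of x = c *\<^sub>C 1" for x :: 'g and c
  proof (rule sep)
    fix f :: "'g list \<Rightarrow> complex"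
    assume f: "envelope_functional f" "f [] = 0"
    note m = envelope_functional_multilinear[OF f(1)]
    have "abs_enveloping_algebra (tensor_of x - c *\<^sub>C 1) = 0"
      by (simp add: complex_linear_diff[OF complex_linear_envelope] envelope_simps that)
    from envelope_functional_vanishes[OF f(1) this]
    have "tensor_lift f (pure_tensor [x]) - c *\<^sub>C tensor_lift f (pure_tensor []) = 0"
      by (simp add: complex_linear_diff[OF complex_linear_tensor_lift[OF m]]
          complex_linear_scaleC[OF complex_linear_tensor_lift[OF m]])
    then show "f [x] = 0"
      unfolding tensor_lift_pure[OF m] using f(2) by simp
  qed
  have inj: "inj (envelope_of :: 'g \<Rightarrow> _)"
  proof (rule injI)
    fix x y :: 'g assume "envelope_of x = envelope_of y"
    then have "envelope_of (x - y) = 0 *\<^sub>C 1" by (simp add: complex_linear_diff[OF e])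
    from scalar[OF this] show "x = y" by simp
  qed
  obtain B :: "'g set" where B: "cvec.independent B" "cvec.span B = UNIV"
    using cvec.basis_exists[of "UNIV :: 'g set"] by (metis top.extremum_uniqueI)
  have "(1 :: 'g enveloping_algebra) \<notin> cvec.span (envelope_of ` B)"
  proof
    assume "(1 :: 'g enveloping_algebra) \<in> cvec.span (envelope_of ` B)"
    then obtain x :: 'g where x: "envelope_of x = 1"
      unfolding linear_span_image[OF L] by (metis imageE)
    with scalar[of x 1] have "x = 0" by (simp add: scaleC_one)
    with x show False by (simp add: complex_linear_zero[OF e])
  qed
  moreover have "cvec.independent (envelope_of ` B)"
    by (rule linear_independent_injective_image[OF L B(1)]) (use inj in \<open>auto simp: inj_on_def\<close>)
  ultimately have "cvec.independent (insert 1 (envelope_of ` B))"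
    by (rule cvec.independent_insertI)
  then obtain h :: "'g enveloping_algebra \<Rightarrow> complex" where h: "complex_linear h"
    "\<And>b. b \<in> insert 1 (envelope_of ` B) \<Longrightarrow> h b = (if b = 1 then 0 else \<phi> (inv envelope_of b))"
    using functional_extension[of "insert 1 (envelope_of ` B)"
        "\<lambda>b. if b = 1 then 0 else \<phi> (inv envelope_of b)"] by metis
  have "h (envelope_of x) = \<phi> x" for x
  proof (rule complex_linear_eq_on_span[OF complex_linear_compose[OF h(1) e] lin, of x B])
    fix b assume b: "b \<in> B"
    have "envelope_of b \<noteq> 1"
      using \<open>1 \<notin> cvec.span (envelope_of ` B)\<close> b by (metis cvec.span_base imageI)
    then show "h (envelope_of b) = \<phi> b" using h(2)[of "envelope_of b"] b inj by simp
  qed (simp add: B)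
  moreover have "h 1 = 0" using h(2) by simp
  ultimately show ?thesis
    using envelope_functional_compose[OF h(1)] by (intro exI[of _ "\<lambda>w. h (envelope_word w)"]) simp
qed

text \<open>Descent on the degree. Split s = s' + t with t in the span of n-th powers. The
  convolution functional vanishes on s, which maps to 0, and on the shorter powers in s', so n!
  times the product of the \<phi>'s vanishes on t. Such products separate tensors, hence t =
  0.\<close>

lemma symmetric_tensors_embed:
  fixes s :: "'g::complex_lie_algebra tensor_algebra"
  assumes ext: "\<And>\<phi> :: 'g \<Rightarrow> complex. complex_linear \<phi> \<Longrightarrow>
      \<exists>f. envelope_functional f \<and> f [] = 0 \<and> (\<forall>x. f [x] = \<phi> x)"
    and s: "s \<in> cvec.span {tensor_of x ^ n | x n. True}" and zero: "abs_enveloping_algebra s = 0"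
  shows "s = 0"
proof -
  define Q :: "nat \<Rightarrow> 'g tensor_algebra set" where "Q n = cvec.span {tensor_of x ^ k | x k. k < n}" for n
  have step: "s \<in> Q n" if sQ: "s \<in> Q (Suc n)" for n
  proof -
    have "{tensor_of x ^ k | x k. k < Suc n} =
        {tensor_of x ^ k | x k. k < n} \<union> range (\<lambda>x :: 'g. tensor_of x ^ n)"
      using less_Suc_eq by auto
    then obtain s' t where s't: "s = s' + t" "s' \<in> Q n" "t \<in> cvec.span (range (\<lambda>x. tensor_of x ^ n))"
      using sQ by (auto simp: Q_def cvec.span_Un)
    have "t = 0"
    proof (rule product_functionals_separate)
      fix \<phi>s :: "('g \<Rightarrow> complex) list"
      assume lin: "\<And>\<phi>. \<phi> \<in> set \<phi>s \<Longrightarrow> complex_linear \<phi>"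
      let ?P = "tensor_lift (product_map \<phi>s)"
      note m = multilinear_product_map[of \<phi>s, OF lin]
      have pow: "?P (tensor_of x ^ k) = product_map \<phi>s (replicate k x)" for x k
        using tensor_lift_pure[OF m, of "replicate k x"] by (simp add: pure_tensor_replicate)
      show "?P t = 0"
      proof (cases "length \<phi>s = n")
        \<comment> \<open>A product with a number of factors other than n vanishes on n-th powers by
          length alone.\<close>
        case False
        have "?P t = (\<lambda>_. 0) t"
        proof (rule complex_linear_eq_on_span[OF complex_linear_tensor_lift[OF m] complex_linear_zero_fun s't(3)])
          fix r assume "r \<in> range (\<lambda>x :: 'g. tensor_of x ^ n)"
          then obtain x where "r = tensor_of x ^ n" by blast
          then show "?P r = 0"
            using False product_map_length[of "replicate n x" \<phi>s] pow by simp
        qed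
        then show ?thesis by simp
      next
        case True
        obtain f where f: "envelope_functional f" "\<And>w. length w < n \<Longrightarrow> f w = 0"
          "\<And>x. f (replicate n x) = fact n * product_map \<phi>s (replicate n x)"
          using convolution_extends_product[of \<phi>s, OF ext lin] True by blast
        note mf = envelope_functional_multilinear[OF f(1)]
        have powf: "tensor_lift f (tensor_of x ^ k) = f (replicate k x)" for x k
          using tensor_lift_pure[OF mf, of "replicate k x"] by (simp add: pure_tensor_replicate)
        have "tensor_lift f s' = (\<lambda>_. 0) s'"
          by (rule complex_linear_eq_on_span[OF complex_linear_tensor_lift[OF mf] complex_linear_zero_fun
                s't(2)[unfolded Q_def]]) (auto simp: powf f(2))
        moreover have "tensor_lift f t = (\<lambda>t. fact n *\<^sub>C ?P t) t"
          by (rule complex_linear_eq_on_span[OF complex_linear_tensor_lift[OF mf]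
                complex_linear_scale_fun[OF complex_linear_tensor_lift[OF m]] s't(3)])
            (auto simp: powf pow f(3) scaleC_complex_def)
        moreover have "tensor_lift f s = 0"
          by (rule envelope_functional_vanishes[OF f(1) zero])
        ultimately have "fact n * ?P t = 0"
          by (simp add: s't(1) complex_linear_add[OF complex_linear_tensor_lift[OF mf]] scaleC_complex_def)
        then show ?thesis by simp
      qed
    qed
    then show ?thesis using s't by simp
  qed
  have mono: "Q m \<subseteq> Q n" if "m \<le> n" for m n
    unfolding Q_def by (rule cvec.span_mono) (use that in \<open>blast intro: less_le_trans\<close>)
  have "\<exists>n. s \<in> Q n" using s
  proof (induction rule: cvec.span_induct_alt)
    case base
    show ?case by (auto simp: Q_def intro: cvec.span_zero)
  next
    case (step c x y)
    then obtain z k n where x: "x = tensor_of z ^ k" and y: "y \<in> Q n" by blast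
    have "x \<in> Q (Suc k)" unfolding Q_def x by (rule cvec.span_base) blast
    with y mono[of "Suc k" "max (Suc k) n"] mono[of n "max (Suc k) n"]
    have "c *\<^sub>C x + y \<in> Q (max (Suc k) n)"
      unfolding Q_def by (intro cvec.span_add cvec.span_scale) auto
    then show ?case by blast
  qed
  then obtain n where "s \<in> Q n" by blast
  then have "s \<in> Q 0" by (induction n) (use step in blast)+
  then show ?thesis by (simp add: Q_def)
qed

section \<open>Evaluation of tensors\<close>

lemma tensor_lift_product_map_one:
  assumes "\<And>h. h \<in> set hs \<Longrightarrow> complex_linear h"
  shows "tensor_lift (product_map hs) 1 = (if hs = [] then 1 else 0)"
proof -
  have "multilinear (product_map hs)" by (rule multilinear_product_map) (rule assms)
  then have "tensor_lift (product_map hs) 1 = product_map hs []" by (rule tensor_lift_one)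
  then show ?thesis by (cases hs) simp_all
qed

lemma tensor_lift_product_map_Nil:
  "tensor_lift (product_map [] :: 'a::complex_vector list \<Rightarrow> 'b::complex_algebra_1) (tensor_of x * \<theta>) = 0"
proof (rule complex_linear_eq_on_pure[where g = "\<lambda>_. 0" and \<theta> = \<theta>])
  have m: "multilinear (product_map [] :: 'a list \<Rightarrow> 'b)"
    by (rule multilinear_product_map) simp
  show "complex_linear (\<lambda>\<theta>. tensor_lift (product_map [] :: 'a list \<Rightarrow> 'b) (tensor_of x * \<theta>))"
    by (rule complex_linear_compose[OF complex_linear_tensor_lift[OF m] complex_linear_mult_left])
  show "tensor_lift (product_map [] :: 'a list \<Rightarrow> 'b) (tensor_of x * pure_tensor w) = 0" for w
    using tensor_lift_pure[OF m, of "x # w"] by simp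
qed (rule complex_linear_zero_fun)

lemma tensor_lift_product_map_Cons:
  assumes "\<And>g. g \<in> set (h # hs) \<Longrightarrow> complex_linear g"
  shows "tensor_lift (product_map (h # hs)) (tensor_of x * \<theta>) = h x * tensor_lift (product_map hs) \<theta>"
proof (rule complex_linear_eq_on_pure[where \<theta> = \<theta>])
  note m = multilinear_product_map[of "h # hs", OF assms]
  have m': "multilinear (product_map hs)"
    by (rule multilinear_product_map) (simp add: assms)
  show "complex_linear (\<lambda>\<theta>. tensor_lift (product_map (h # hs)) (tensor_of x * \<theta>))"
    by (rule complex_linear_compose[OF complex_linear_tensor_lift[OF m] complex_linear_mult_left])
  show "complex_linear (\<lambda>\<theta>. h x * tensor_lift (product_map hs) \<theta>)"
    by (rule complex_linear_compose[OF complex_linear_mult_left complex_linear_tensor_lift[OF m']])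
  show "tensor_lift (product_map (h # hs)) (tensor_of x * pure_tensor w) =
      h x * tensor_lift (product_map hs) (pure_tensor w)" for w
    using tensor_lift_pure[OF m, of "x # w"] tensor_lift_pure[OF m', of w] by simp
qed

text \<open>For homogeneous \<open>a\<close> only the cut at its degree can contribute. Summing over
  all cuts makes the formula linear in \<open>a\<close>, so that it holds without
  homogeneity.\<close>

lemma tensor_lift_product_map_mult:
  assumes "\<And>h. h \<in> set hs \<Longrightarrow> complex_linear h"
  shows "tensor_lift (product_map hs) (a * b) =
    (\<Sum>i\<le>length hs. tensor_lift (product_map (take i hs)) a * tensor_lift (product_map (drop i hs)) b)"
  using assms
proof (induction a arbitrary: hs rule: tensor_algebra_induct)
  case one
  have "(\<Sum>i\<le>length hs. tensor_lift (product_map (take i hs)) 1 * tensor_lift (product_map (drop i hs)) b)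
      = (\<Sum>i\<le>length hs. if i = 0 then tensor_lift (product_map hs) b else 0)"
  proof (rule sum.cong[OF refl])
    fix i assume "i \<in> {..length hs}"
    have "tensor_lift (product_map (take i hs)) 1 = (if take i hs = [] then 1 else 0)"
      by (rule tensor_lift_product_map_one) (use one in \<open>auto dest: in_set_takeD\<close>)
    then show "tensor_lift (product_map (take i hs)) 1 * tensor_lift (product_map (drop i hs)) b
        = (if i = 0 then tensor_lift (product_map hs) b else 0)"
      using \<open>i \<in> {..length hs}\<close> by (cases i) auto
  qed
  then show ?case by simp
next
  case (mult x a)
  show ?case
  proof (cases hs)
    case Nil
    then show ?thesis
      by (simp add: tensor_lift_product_map_Nil mult.assoc)
  next
    case (Cons h hs')
    have lin: "complex_linear g" if "g \<in> set (h # hs')" for g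
      using mult.prems that Cons by simp
    have "tensor_lift (product_map hs) (tensor_of x * a * b) =
        h x * tensor_lift (product_map hs') (a * b)"
      unfolding mult.assoc Cons by (rule tensor_lift_product_map_Cons[OF lin])
    also have "\<dots> = (\<Sum>i\<le>length hs'. h x * tensor_lift (product_map (take i hs')) a *
        tensor_lift (product_map (drop i hs')) b)"
      using mult.IH[of hs'] lin by (simp add: sum_distrib_left mult.assoc)
    also have "\<dots> = (\<Sum>i\<le>length hs'. tensor_lift (product_map (take (Suc i) hs)) (tensor_of x * a) *
        tensor_lift (product_map (drop (Suc i) hs)) b)"
    proof (rule sum.cong[OF refl])
      fix i
      have "tensor_lift (product_map (take (Suc i) hs)) (tensor_of x * a) =
          h x * tensor_lift (product_map (take i hs')) a"
        unfolding Cons take_Suc_Cons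
        by (rule tensor_lift_product_map_Cons) (use lin in \<open>auto dest: in_set_takeD\<close>)
      then show "h x * tensor_lift (product_map (take i hs')) a * tensor_lift (product_map (drop i hs')) b =
          tensor_lift (product_map (take (Suc i) hs)) (tensor_of x * a) *
          tensor_lift (product_map (drop (Suc i) hs)) b"
        by (simp add: Cons)
    qed
    \<comment> \<open>The new term i = 0 is zero, because \<open>tensor_of x * a\<close> has no
      component of degree 0.\<close>
    also have "\<dots> = (\<Sum>i\<le>length hs. tensor_lift (product_map (take i hs)) (tensor_of x * a) *
        tensor_lift (product_map (drop i hs)) b)"
      unfolding Cons list.size sum.atMost_Suc_shift add_0_right add_Suc_right
      by (simp add: tensor_lift_product_map_Nil)
    finally show ?thesis .
  qed
next
  case (add a a')
  have "complex_linear (tensor_lift (product_map (take i hs)))" for i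
    by (rule complex_linear_tensor_lift, rule multilinear_product_map)
      (use add.prems in \<open>auto dest: in_set_takeD\<close>)
  then show ?case
    using add.IH[OF add.prems]
      complex_linear_add[OF complex_linear_tensor_lift[OF multilinear_product_map[OF add.prems]]]
    by (simp add: distrib_right complex_linear_add sum.distrib)
next
  case (scale c a)
  have "complex_linear (tensor_lift (product_map (take i hs)))" for i
    by (rule complex_linear_tensor_lift, rule multilinear_product_map)
      (use scale.prems in \<open>auto dest: in_set_takeD\<close>)
  then show ?case
    using scale.IH[OF scale.prems]
      complex_linear_scaleC[OF complex_linear_tensor_lift[OF multilinear_product_map[OF scale.prems]]]
    by (simp add: mult_scaleC_left complex_linear_scaleC cvec.scale_sum_right)
qed

lemma tensor_lift_product_map_degree:
  assumes "\<And>h. h \<in> set hs \<Longrightarrow> complex_linear h" "\<theta> \<in> tensor_power k" "k \<noteq> length hs"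
  shows "tensor_lift (product_map hs) \<theta> = 0"
proof -
  note m = multilinear_product_map[of hs, OF assms(1)]
  show ?thesis
    by (rule complex_linear_eq_on_span[OF complex_linear_tensor_lift[OF m] complex_linear_zero_fun
          assms(2)[unfolded tensor_power_def]])
      (use assms(3) in \<open>auto simp: tensor_lift_pure[OF m] product_map_length\<close>)
qed

lemma tensor_eval_eq:
  "tensor_eval \<theta> Ps = tensor_lift (product_map (map (\<lambda>P x. envelope_of (current x P)) Ps)) \<theta>"
proof -
  have "(\<lambda>w :: 'a list. if length w = length Ps
      then prod_list (map2 (\<lambda>x P. envelope_of (current x P)) w Ps) else 0) =
      product_map (map (\<lambda>P x. envelope_of (current x P)) Ps)"
    by (auto simp: fun_eq_iff product_map_map product_map_length)
  then show ?thesis by (simp only: tensor_eval_def)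
qed

lemma complex_linear_envelope_current: "complex_linear (\<lambda>x. envelope_of (current x P))"
  by (rule complex_linear_compose[OF complex_linear_envelope_of])
    (rule complex_linearI, simp_all add: current_add_left current_scaleC_left)

lemma tensor_eval_simps:
  shows "tensor_eval 1 Ps = (if Ps = [] then 1 else 0)"
    and "tensor_eval (tensor_of x * \<theta>) [] = 0"
    and "tensor_eval (tensor_of x * \<theta>) (P # Ps) = envelope_of (current x P) * tensor_eval \<theta> Ps"
  unfolding tensor_eval_eq list.map
  by (subst tensor_lift_product_map_one tensor_lift_product_map_Nil tensor_lift_product_map_Cons;
      auto simp: complex_linear_envelope_current)+

lemma tensor_eval_mult:
  "tensor_eval (a * b) Ps = (\<Sum>i\<le>length Ps. tensor_eval a (take i Ps) * tensor_eval b (drop i Ps))"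
  unfolding tensor_eval_eq
  by (subst tensor_lift_product_map_mult)
    (auto simp: complex_linear_envelope_current take_map drop_map)

lemma tensor_eval_degree:
  "\<theta> \<in> tensor_power k \<Longrightarrow> k \<noteq> length Ps \<Longrightarrow> tensor_eval \<theta> Ps = 0"
  unfolding tensor_eval_eq
  by (rule tensor_lift_product_map_degree) (auto simp: complex_linear_envelope_current)

text \<open>Since [y(1), x(P)] = [y, x](P), the action of g leaves the polynomials alone; hence
  invariant tensors evaluate to invariants.\<close>

lemma tensor_eval_ad:
  "tensor_eval (tensor_ad y \<theta>) Ps =
    envelope_of (current y 1) * tensor_eval \<theta> Ps - tensor_eval \<theta> Ps * envelope_of (current y 1)"
proof (induction \<theta> arbitrary: Ps rule: tensor_algebra_induct)
  case one
  show ?case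
    by (simp add: tensor_ad_one complex_linear_zero[OF complex_linear_tensor_eval] tensor_eval_simps(1))
next
  case (mult x \<theta>)
  show ?case
  proof (cases Ps)
    case Nil
    then show ?thesis
      by (simp add: tensor_ad_mult complex_linear_add[OF complex_linear_tensor_eval] tensor_eval_simps)
  next
    case (Cons P Ps')
    have "envelope_of (current (lie_bracket y x) P) =
        envelope_of (current y 1) * envelope_of (current x P) - envelope_of (current x P) * envelope_of (current y 1)"
      by (simp add: envelope_of_commutator bracket_current)
    then show ?thesis
      using mult.IH[of Ps']
      by (simp add: Cons tensor_ad_mult complex_linear_add[OF complex_linear_tensor_eval]
          tensor_eval_simps right_diff_distrib left_diff_distrib mult.assoc)
  qed
next
  case (add a b)
  then show ?case
    by (simp add: complex_linear_add[OF complex_linear_tensor_ad]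
        complex_linear_add[OF complex_linear_tensor_eval] algebra_simps)
next
  case (scale c a)
  then show ?case
    by (simp add: complex_linear_scaleC[OF complex_linear_tensor_ad]
        complex_linear_scaleC[OF complex_linear_tensor_eval]
        mult_scaleC_left mult_scaleC_right cvec.scale_right_diff_distrib)
qed

text \<open>The component of a tensor over \<open>\<gg>[t]\<close> in
  \<open>\<gg> t^n\<^sub>1 \<otimes> \<dots> \<otimes> \<gg> t^n\<^sub>k\<close>, identified with \<open>\<gg>\<close>-tensors.\<close>

definition coeff_tensor :: "nat list \<Rightarrow> 'g::complex_lie_algebra poly tensor_algebra \<Rightarrow> 'g tensor_algebra"
  where "coeff_tensor ns = tensor_lift (product_map (map (\<lambda>n x. tensor_of (coeff x n)) ns))"

lemma complex_linear_tensor_of_coeff: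
  "complex_linear (\<lambda>x :: 'g::complex_lie_algebra poly. tensor_of (coeff x n))"
  by (rule complex_linearI) (simp_all add: tensor_of_add tensor_of_scaleC)

lemma multilinear_coeff_product:
  "multilinear (product_map (map (\<lambda>n x :: 'g::complex_lie_algebra poly. tensor_of (coeff x n)) ns))"
  by (rule multilinear_product_map) (auto simp: complex_linear_tensor_of_coeff)

lemma complex_linear_coeff_tensor: "complex_linear (coeff_tensor ns)"
  unfolding coeff_tensor_def by (rule complex_linear_tensor_lift[OF multilinear_coeff_product])

lemma coeff_tensor_simps:
  shows "coeff_tensor ns 1 = (if ns = [] then 1 else 0)"
    and "coeff_tensor [] (tensor_of x * s) = 0"
    and "coeff_tensor (n # ns) (tensor_of x * s) = tensor_of (coeff x n) * coeff_tensor ns s"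
  unfolding coeff_tensor_def list.map
  by (subst tensor_lift_product_map_one tensor_lift_product_map_Nil tensor_lift_product_map_Cons;
      auto simp: complex_linear_tensor_of_coeff)+

lemma coeff_lie_bracket_current:
  "coeff (lie_bracket (current y 1) p) n = lie_bracket y (coeff p n)"
proof (rule poly_additive_eqI[where p = p])
  fix x m
  have "current y 1 = monom y 0" using current_monom[of y 0] by simp
  then show "coeff (lie_bracket (current y 1) (monom x m)) n = lie_bracket y (coeff (monom x m) n)"
    by (simp add: lie_bracket_monom)
qed (simp_all add: bracket_add_right)

text \<open>Bracketing with y(1) preserves powers of t, so each component of a g-invariant tensor
  over g[t] is an invariant tensor over g.\<close>

lemma coeff_tensor_ad:
  "coeff_tensor ns (tensor_ad (current y 1) s) = tensor_ad y (coeff_tensor ns s)"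
proof (induction s arbitrary: ns rule: tensor_algebra_induct)
  case one
  show ?case
    by (simp add: tensor_ad_one complex_linear_zero[OF complex_linear_coeff_tensor] coeff_tensor_simps(1)
        complex_linear_zero[OF complex_linear_tensor_ad])
next
  case (mult x s)
  then show ?case
    by (cases ns) (simp_all add: tensor_ad_mult complex_linear_add[OF complex_linear_coeff_tensor]
        coeff_tensor_simps coeff_lie_bracket_current complex_linear_zero[OF complex_linear_tensor_ad])
next
  case (add a b)
  then show ?case
    by (simp add: complex_linear_add[OF complex_linear_tensor_ad]
        complex_linear_add[OF complex_linear_coeff_tensor])
next
  case (scale c a)
  then show ?case
    by (simp add: complex_linear_scaleC[OF complex_linear_tensor_ad]
        complex_linear_scaleC[OF complex_linear_coeff_tensor])
qed

lemma coeff_tensor_power: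
  "coeff_tensor ns (tensor_of x ^ k) = (if length ns = k then pure_tensor (map (coeff x) ns) else 0)"
proof (induction k arbitrary: ns)
  case 0
  show ?case by (simp add: coeff_tensor_simps(1))
next
  case (Suc k)
  then show ?case by (cases ns) (simp_all add: coeff_tensor_simps)
qed

text \<open>On a power, the order of \<open>ns\<close> matters only as the order of the letters of a
  word in U(g[t]); this is what makes sorting possible.\<close>

lemma tensor_eval_nat_coeff_tensor_power:
  "tensor_eval_nat (coeff_tensor ns (tensor_of x ^ k)) ns =
    (if length ns = k then envelope_word (map (\<lambda>n. monom (coeff x n) n) ns) else 0)"
proof (cases "length ns = k")
  case True
  have "tensor_eval_nat (pure_tensor (map (coeff x) ns)) ns = envelope_word (map (\<lambda>n. monom (coeff x n) n) ns)"
    by (induction ns) (simp_all add: tensor_eval_nat_def tensor_eval_simps current_monom)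
  then show ?thesis by (simp add: coeff_tensor_power True)
next
  case False
  then show ?thesis
    by (simp add: coeff_tensor_power tensor_eval_nat_def complex_linear_zero[OF complex_linear_tensor_eval])
qed

lemma complex_linear_tensor_eval_nat: "complex_linear (\<lambda>\<theta>. tensor_eval_nat \<theta> ns)"
  unfolding tensor_eval_nat_def by (rule complex_linear_tensor_eval)

lemma envelope_sum_coefficients:
  "envelope_of p = (\<Sum>n\<le>degree p. envelope_of (current (coeff p n) (monom 1 n)))"
proof -
  have "envelope_of p = envelope_of (\<Sum>n\<le>degree p. monom (coeff p n) n)"
    by (simp add: poly_as_sum_of_monoms)
  also have "\<dots> = (\<Sum>n\<le>degree p. envelope_of (current (coeff p n) (monom 1 n)))"
    by (simp add: complex_linear_sum[OF complex_linear_envelope_of] current_monom)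
  finally show ?thesis .
qed

text \<open>A tensor over g[t] is the finite sum of its components, and
  \<open>tensor_eval_nat\<close> puts the powers of t back. The vanishing outside \<open>A\<close>
  is stated so that two such sums can be extended to a common index set.\<close>

lemma coeff_tensor_decomposition:
  fixes s :: "'g::complex_lie_algebra poly tensor_algebra"
  shows "\<exists>A. finite A \<and> (\<forall>ns. ns \<notin> A \<longrightarrow> coeff_tensor ns s = 0) \<and>
    abs_enveloping_algebra s = (\<Sum>ns\<in>A. tensor_eval_nat (coeff_tensor ns s) ns)"
proof (induction s rule: tensor_algebra_induct)
  case one
  show ?case
    by (rule exI[of _ "{[]}"])
      (simp add: coeff_tensor_simps(1) envelope_one tensor_eval_nat_def tensor_eval_simps(1))
next
  case (mult x s)
  then obtain A where A: "finite A" "\<And>ns. ns \<notin> A \<Longrightarrow> coeff_tensor ns s = 0"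
    "abs_enveloping_algebra s = (\<Sum>ns\<in>A. tensor_eval_nat (coeff_tensor ns s) ns)" by blast
  define A' where "A' = (\<lambda>(n, ns). n # ns) ` ({..degree x} \<times> A)"
  have "coeff_tensor ns (tensor_of x * s) = 0" if "ns \<notin> A'" for ns
  proof (cases ns)
    case Nil
    then show ?thesis by (simp add: coeff_tensor_simps)
  next
    case (Cons n ns')
    with that have "n > degree x \<or> ns' \<notin> A" by (force simp: A'_def)
    then show ?thesis
      by (auto simp: Cons coeff_tensor_simps coeff_eq_0 A(2) complex_linear_zero[OF complex_linear_tensor_of])
  qed
  moreover have "(\<Sum>ns\<in>A'. tensor_eval_nat (coeff_tensor ns (tensor_of x * s)) ns) =
      (\<Sum>(n, ns)\<in>{..degree x} \<times> A. envelope_of (current (coeff x n) (monom 1 n)) *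
        tensor_eval_nat (coeff_tensor ns s) ns)"
    unfolding A'_def
    by (subst sum.reindex)
      (auto simp: inj_on_def coeff_tensor_simps tensor_eval_nat_def tensor_eval_simps intro!: sum.cong)
  then have "abs_enveloping_algebra (tensor_of x * s) =
      (\<Sum>ns\<in>A'. tensor_eval_nat (coeff_tensor ns (tensor_of x * s)) ns)"
    by (simp add: envelope_simps A(3) envelope_sum_coefficients[of x] sum_product sum.cartesian_product)
  ultimately show ?case using A(1) by (intro exI[of _ A']) (simp add: A'_def)
next
  case (add a b)
  then obtain A B where A: "finite A" "\<And>ns. ns \<notin> A \<Longrightarrow> coeff_tensor ns a = 0"
    "abs_enveloping_algebra a = (\<Sum>ns\<in>A. tensor_eval_nat (coeff_tensor ns a) ns)"
    and B: "finite B" "\<And>ns. ns \<notin> B \<Longrightarrow> coeff_tensor ns b = 0"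
    "abs_enveloping_algebra b = (\<Sum>ns\<in>B. tensor_eval_nat (coeff_tensor ns b) ns)" by blast
  have "(\<Sum>ns\<in>A. tensor_eval_nat (coeff_tensor ns a) ns) = (\<Sum>ns\<in>A \<union> B. tensor_eval_nat (coeff_tensor ns a) ns)"
    by (rule sum.mono_neutral_left)
      (use A B in \<open>auto simp: complex_linear_zero[OF complex_linear_tensor_eval_nat]\<close>)
  moreover have "(\<Sum>ns\<in>B. tensor_eval_nat (coeff_tensor ns b) ns) = (\<Sum>ns\<in>A \<union> B. tensor_eval_nat (coeff_tensor ns b) ns)"
    by (rule sum.mono_neutral_left)
      (use A B in \<open>auto simp: complex_linear_zero[OF complex_linear_tensor_eval_nat]\<close>)
  ultimately show ?case
    using A B by (intro exI[of _ "A \<union> B"])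
      (simp add: envelope_simps complex_linear_add[OF complex_linear_coeff_tensor]
        complex_linear_add[OF complex_linear_tensor_eval_nat] sum.distrib)
next
  case (scale c a)
  then show ?case
    by (auto simp: envelope_simps complex_linear_scaleC[OF complex_linear_coeff_tensor]
        complex_linear_scaleC[OF complex_linear_tensor_eval_nat] cvec.scale_sum_right intro: exI)
qed

section \<open>Current algebras of reductive Lie algebras\<close>

text \<open>The center is an ideal, so it has a complementary ideal J. Brackets do not see central
  summands, so all of them lie in J.\<close>

lemma reductive_center_meets_derived:
  fixes a :: "'g::complex_lie_algebra"
  assumes red: "reductive TYPE('g)" and a: "\<And>y. lie_bracket a y = 0"
    and D: "a \<in> cvec.span {lie_bracket x y | x y :: 'g. True}"
  shows "a = 0"
proof -
  define Z where "Z = {z :: 'g. \<forall>y. lie_bracket z y = 0}"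
  have "lie_bracket x z = 0" if "z \<in> Z" for x z
    using that bracket_swap[of x z] by (simp add: Z_def)
  then have Z: "lie_ideal Z"
    by (auto simp: lie_ideal_def Z_def intro!: cvec.subspaceI simp: bracket_add_left bracket_scaleC_left)
  obtain J where J: "lie_ideal J" "Z \<inter> J = {0}" "{a + b | a b. a \<in> Z \<and> b \<in> J} = UNIV"
    by (rule exE[OF red[unfolded reductive_def, rule_format, OF Z]], elim conjE, rule that)
  have "lie_bracket x y \<in> J" for x y
  proof -
    obtain z b where y: "y = z + b" "z \<in> Z" "b \<in> J" using J(3) by blast
    have "lie_bracket x y = lie_bracket x b"
      using y \<open>\<And>x z. z \<in> Z \<Longrightarrow> lie_bracket x z = 0\<close> by (simp add: bracket_add_right)
    then show ?thesis using J(1) y(3) by (simp add: lie_ideal_def)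
  qed
  then have "cvec.span {lie_bracket x y | x y :: 'g. True} \<subseteq> J"
    using J(1) by (intro cvec.span_minimal) (auto simp: lie_ideal_def)
  then show ?thesis using D J(2) a by (auto simp: Z_def)
qed

text \<open>Matrix coefficients of the adjoint representation.\<close>

lemma envelope_functional_adjoint:
  fixes z :: "'l::complex_lie_algebra" and \<psi> :: "'l \<Rightarrow> complex"
  assumes "complex_linear \<psi>"
  shows "envelope_functional (\<lambda>w. if w = [] then 0 else \<psi> (foldr lie_bracket w z))"
  unfolding envelope_functional_def
proof (intro conjI allI multilinearI)
  fix u v :: "'l list"
  have "complex_linear (\<lambda>x. foldr lie_bracket (u @ x # v) z)"
  proof (induction u)
    case Nil
    show ?case by (simp add: complex_linear_bracket_left)
  next
    case (Cons y u)
    from complex_linear_compose[OF complex_linear_bracket_right this] show ?case by simp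
  qed
  from complex_linear_compose[OF assms this]
  show "complex_linear (\<lambda>x. if u @ x # v = [] then 0 else \<psi> (foldr lie_bracket (u @ x # v) z))"
    by simp
  fix x y :: 'l
  have jac: "lie_bracket x (lie_bracket y t) = lie_bracket y (lie_bracket x t) + lie_bracket (lie_bracket x y) t" for t
    using jacobi[of x y t] bracket_swap[of t x] bracket_swap[of t "lie_bracket x y"]
      complex_linear_diff[OF complex_linear_bracket_right, of y 0 "lie_bracket x t"]
    by (simp add: algebra_simps)
  have "foldr lie_bracket (u @ x # y # v) z =
      foldr lie_bracket (u @ y # x # v) z + foldr lie_bracket (u @ lie_bracket x y # v) z"
    by (induction u) (simp_all add: jac bracket_add_right)
  \<comment> \<open>The relation never involves the empty word, so the value there may be 0 instead
    of \<open>\<psi> z\<close>, which makes the functional vanish at 1.\<close>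
  then show "(if u @ x # y # v = [] then 0 else \<psi> (foldr lie_bracket (u @ x # y # v) z)) =
      (if u @ y # x # v = [] then 0 else \<psi> (foldr lie_bracket (u @ y # x # v) z)) +
      (if u @ lie_bracket x y # v = [] then 0 else \<psi> (foldr lie_bracket (u @ lie_bracket x y # v) z))"
    by (simp add: complex_linear_add[OF assms])
qed

text \<open>Not the multiplicative extension of \<chi>, but the derivation at the counit with the
  same values on L. It is zero on longer words, which is consistent because \<chi> kills
  brackets.\<close>

lemma envelope_functional_character:
  fixes \<chi> :: "'l::complex_lie_algebra \<Rightarrow> complex"
  assumes "complex_linear \<chi>" "\<And>x y. \<chi> (lie_bracket x y) = 0"
  shows "envelope_functional (\<lambda>w. if length w = 1 then \<chi> (hd w) else 0)"
  unfolding envelope_functional_def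
proof (intro conjI allI multilinearI)
  fix u v :: "'l list"
  show "complex_linear (\<lambda>x. if length (u @ x # v) = 1 then \<chi> (hd (u @ x # v)) else 0)"
    by (cases u; cases v) (simp_all add: assms(1) complex_linear_zero_fun)
  fix x y
  show "(if length (u @ x # y # v) = 1 then \<chi> (hd (u @ x # y # v)) else 0) =
      (if length (u @ y # x # v) = 1 then \<chi> (hd (u @ y # x # v)) else 0) +
      (if length (u @ lie_bracket x y # v) = 1 then \<chi> (hd (u @ lie_bracket x y # v)) else 0)"
    by (cases u; cases v) (simp_all add: assms(2))
qed

lemma current_algebra_separated:
  fixes x :: "'g::complex_lie_algebra poly"
  assumes red: "reductive TYPE('g)"
    and zero: "\<And>f. envelope_functional f \<Longrightarrow> f [] = 0 \<Longrightarrow> f [x] = 0"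
  shows "x = 0"
proof -
  have central: "lie_bracket x z = 0" for z
  proof (rule ccontr)
    assume "lie_bracket x z \<noteq> 0"
    then obtain \<psi> :: "'g poly \<Rightarrow> complex" where \<psi>: "complex_linear \<psi>" "\<psi> (lie_bracket x z) = 1"
      using separating_functional[of "lie_bracket x z" "{}"] by auto
    from zero[OF envelope_functional_adjoint[OF \<psi>(1), of z]] \<psi>(2) show False by simp
  qed
  have "coeff x n = 0" for n
  proof (rule reductive_center_meets_derived[OF red])
    show "lie_bracket (coeff x n) y = 0" for y
    proof -
      have "coeff (lie_bracket (current y 1) x) n = 0"
        using central[of "current y 1"] bracket_swap[of x "current y 1"] by simp
      then show ?thesis
        using bracket_swap[of "coeff x n" y] by (simp add: coeff_lie_bracket_current)
    qed
    show "coeff x n \<in> cvec.span {lie_bracket a b | a b :: 'g. True}"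
    proof (rule ccontr)
      assume "coeff x n \<notin> cvec.span {lie_bracket a b | a b :: 'g. True}"
      then obtain h :: "'g \<Rightarrow> complex" where h: "complex_linear h"
        "\<And>d. d \<in> {lie_bracket a b | a b. True} \<Longrightarrow> h d = 0" "h (coeff x n) = 1"
        by (rule separating_functional) (rule that)
      \<comment> \<open>The map \<open>\<lambda>p. h (coeff p n)\<close> is a character of g[t]:
        coefficients of a bracket are sums of brackets in g, where \<open>h\<close>
        vanishes.\<close>
      have "complex_linear (\<lambda>p :: 'g poly. coeff p n)" by (rule complex_linearI) simp_all
      from complex_linear_compose[OF h(1) this] have lin: "complex_linear (\<lambda>p. h (coeff p n))" .
      have "h (coeff (lie_bracket p q) n) = 0" for p q :: "'g poly"
      proof -
        have "h (if i + j = n then lie_bracket (coeff p i) (coeff q j) else 0) = 0" for i j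
          using h(2) complex_linear_zero[OF h(1)] by auto
        then show ?thesis
          by (simp add: lie_bracket_poly_def coeff_sum complex_linear_sum[OF h(1)])
      qed
      from zero[OF envelope_functional_character[OF lin this]] h(3) show False by simp
    qed
  qed
  then show ?thesis by (simp add: poly_eq_iff)
qed

section \<open>Invariants of U(g[t]) from invariant tensors\<close>

lemma complex_subalgebra_current_invariants: "complex_subalgebra current_invariants"
  unfolding complex_subalgebra_def
proof (intro conjI ballI cvec.subspaceI)
  fix u v :: "'a poly enveloping_algebra" and c
  assume u: "u \<in> current_invariants"
  show "c *\<^sub>C u \<in> current_invariants"
    using u by (simp add: current_invariants_def mult_scaleC_left mult_scaleC_right
        cvec.scale_right_diff_distrib[symmetric])
  assume v: "v \<in> current_invariants"
  show "u + v \<in> current_invariants"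
    using u v by (simp add: current_invariants_def algebra_simps)
  have "e * (u * v) = (u * v) * e" if "e * u = u * e" "e * v = v * e" for e
    using that by (metis mult.assoc)
  then show "u * v \<in> current_invariants"
    using u v by (simp add: current_invariants_def)
qed (simp_all add: current_invariants_def)

lemma subspace_current_invariants: "cvec.subspace current_invariants"
  by (rule conjunct1[OF complex_subalgebra_current_invariants[unfolded complex_subalgebra_def]])

lemma tensor_eval_nat_invariant:
  "\<theta> \<in> tensor_invariants \<Longrightarrow> tensor_eval_nat \<theta> ns \<in> current_invariants"
  using tensor_eval_ad[of _ \<theta> "map (monom 1) ns", symmetric]
  by (simp add: current_invariants_def tensor_invariants_def tensor_eval_nat_def
      complex_linear_zero[OF complex_linear_tensor_eval])

text \<open>For any lift s of u in Q, the tensor y.s lies in Q by polarization and maps to [y, u] =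
  0, so it is zero by injectivity. The bound k < n is kept for sorting the exponents.\<close>

lemma invariant_symmetric_lift:
  fixes u :: "'g::complex_lie_algebra poly enveloping_algebra"
  assumes red: "reductive TYPE('g)" and u: "u \<in> current_invariants" "u \<in> envelope_filtration n"
  obtains s where "s \<in> cvec.span {tensor_of x ^ k | x k. k < n}" "abs_enveloping_algebra s = u"
    "\<And>y. tensor_ad (current y 1) s = 0"
proof -
  let ?Q = "cvec.span {tensor_of x ^ k | (x :: 'g poly) k. True}"
  have "\<exists>s. s \<in> cvec.span {tensor_of x ^ k | x k. k < n} \<and> abs_enveloping_algebra s = v"
    if "v \<in> cvec.span {envelope_of (x :: 'g poly) ^ k | x k. k < n}" for v
    using that
  proof (induction rule: cvec.span_induct_alt)
    case base
    show ?case by (rule exI[of _ 0]) (simp add: cvec.span_zero complex_linear_zero[OF complex_linear_envelope])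
  next
    case (step c p v)
    then obtain x k s where "p = envelope_of x ^ k" "k < n"
      and s: "s \<in> cvec.span {tensor_of x ^ k | x k. k < n}" "abs_enveloping_algebra s = v" by blast
    then have "abs_enveloping_algebra (c *\<^sub>C tensor_of x ^ k + s) = c *\<^sub>C p + v"
      by (simp add: envelope_simps envelope_power)
    moreover have "tensor_of x ^ k \<in> {tensor_of x ^ k | x k. k < n}" using \<open>k < n\<close> by blast
    then have "c *\<^sub>C tensor_of x ^ k + s \<in> cvec.span {tensor_of x ^ k | x k. k < n}"
      using s(1) by (intro cvec.span_add cvec.span_scale) (simp_all add: cvec.span_base)
    ultimately show ?case by blast
  qed
  then obtain s where s: "s \<in> cvec.span {tensor_of x ^ k | x k. k < n}" "abs_enveloping_algebra s = u"
    using u(2) envelope_filtration_subset_span_powers by blast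
  have Q: "s \<in> ?Q" using s(1) cvec.span_mono[of "{tensor_of x ^ k | (x :: 'g poly) k. k < n}"
        "{tensor_of x ^ k | (x :: 'g poly) k. True}"] by blast
  have pow: "tensor_ad y (tensor_of x ^ k) \<in> ?Q" for x y :: "'g poly" and k
  proof (cases k)
    case 0
    then show ?thesis by (simp add: tensor_ad_one cvec.span_zero)
  next
    case (Suc m)
    have "{(tensor_of x + t *\<^sub>C tensor_of (lie_bracket y x)) ^ Suc m | t. True} \<subseteq>
        {tensor_of x ^ k | (x :: 'g poly) k. True}"
    proof safe
      fix t
      have "tensor_of x + t *\<^sub>C tensor_of (lie_bracket y x) = tensor_of (x + t *\<^sub>C lie_bracket y x)"
        by (simp add: tensor_of_add tensor_of_scaleC)
      then show "\<exists>x' k. (tensor_of x + t *\<^sub>C tensor_of (lie_bracket y x)) ^ Suc m = tensor_of x' ^ k \<and> True"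
        by metis
    qed
    from subsetD[OF cvec.span_mono[OF this] polarization[of "tensor_of x" "tensor_of (lie_bracket y x)" m]]
    show ?thesis by (simp add: Suc tensor_ad_power lessThan_Suc_atMost del: sum.lessThan_Suc power_Suc)
  qed
  have "tensor_ad (current y 1) s = 0" for y
  proof (rule symmetric_tensors_embed)
    show "\<exists>f. envelope_functional f \<and> f [] = 0 \<and> (\<forall>x. f [x] = \<phi> x)"
      if "complex_linear \<phi>" for \<phi> :: "'g poly \<Rightarrow> complex"
      by (rule functional_extends_to_envelope[OF current_algebra_separated[OF red] that])
    show "tensor_ad (current y 1) s \<in> ?Q"
      by (rule complex_linear_span[OF complex_linear_tensor_ad Q]) (use pow in blast)
    show "abs_enveloping_algebra (tensor_ad (current y 1) s) = 0"
      using u(1) by (simp add: envelope_tensor_ad s(2) current_invariants_def)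
  qed
  with s that show ?thesis by blast
qed

text \<open>On symmetric tensors, reordering the exponents only reorders products of elements of
  \<open>\<gg>[t]\<close>, so exponents can be sorted at the cost of terms of lower filtration degree.\<close>

lemma sorting_exponents:
  assumes "s \<in> cvec.span {tensor_of x ^ k | (x :: 'g::complex_lie_algebra poly) k. k < Suc n}"
  shows "tensor_eval_nat (coeff_tensor ns s) ns -
    tensor_eval_nat (coeff_tensor (sort ns) s) (sort ns) \<in> envelope_filtration n"
  unfolding envelope_filtration_def
proof (rule complex_linear_span[OF _ assms])
  show "complex_linear (\<lambda>s :: 'g poly tensor_algebra. tensor_eval_nat (coeff_tensor ns s) ns -
      tensor_eval_nat (coeff_tensor (sort ns) s) (sort ns))"
    by (rule complex_linear_diff_fun[OF
          complex_linear_compose[OF complex_linear_tensor_eval_nat complex_linear_coeff_tensor]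
          complex_linear_compose[OF complex_linear_tensor_eval_nat complex_linear_coeff_tensor]])
  fix r assume "r \<in> {tensor_of x ^ k | (x :: 'g poly) k. k < Suc n}"
  then obtain x :: "'g poly" and k where r: "r = tensor_of x ^ k" "k < Suc n" by blast
  have "tensor_eval_nat (coeff_tensor ns r) ns - tensor_eval_nat (coeff_tensor (sort ns) r) (sort ns)
      \<in> envelope_filtration n"
  proof (cases "length ns = k")
    case True
    let ?w = "map (\<lambda>n. monom (coeff x n) n)"
    \<comment> \<open>Reordering k letters changes the word by an element of level k, and k \<le>
      n.\<close>
    have "mset (?w ns) = mset (?w (sort ns))" by simp
    from envelope_word_permute[OF this]
    show ?thesis
      using envelope_filtration_mono[of k n] r True
      by (auto simp: tensor_eval_nat_coeff_tensor_power)
  next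
    case False
    then show ?thesis
      by (simp add: r tensor_eval_nat_coeff_tensor_power cvec.subspace_0[OF subspace_envelope_filtration])
  qed
  then show "tensor_eval_nat (coeff_tensor ns r) ns - tensor_eval_nat (coeff_tensor (sort ns) r) (sort ns)
      \<in> cvec.span {envelope_word w | w. length w < n}"
    by (simp only: envelope_filtration_def)
qed

lemma current_invariants_in_span:
  fixes u :: "'g::complex_lie_algebra poly enveloping_algebra"
  assumes red: "reductive TYPE('g)" and "u \<in> current_invariants" "u \<in> envelope_filtration n"
  shows "u \<in> cvec.span {tensor_eval_nat \<theta> ns | (\<theta> :: 'g tensor_algebra) ns. \<theta> \<in> tensor_invariants \<and> sorted ns}"
    (is "_ \<in> ?V")
  using assms(2,3)
proof (induction n arbitrary: u)
  case 0
  then show ?case by (simp add: envelope_filtration_def cvec.span_zero)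
next
  case (Suc n)
  obtain s where s: "s \<in> cvec.span {tensor_of x ^ k | (x :: 'g poly) k. k < Suc n}"
    "abs_enveloping_algebra s = u" "\<And>y. tensor_ad (current y 1) s = 0"
    using invariant_symmetric_lift[OF red Suc.prems] by blast
  have inv: "coeff_tensor ns s \<in> tensor_invariants" for ns
    by (simp add: tensor_invariants_def coeff_tensor_ad[symmetric] s(3)
        complex_linear_zero[OF complex_linear_coeff_tensor])
  obtain A where A: "finite A" "u = (\<Sum>ns\<in>A. tensor_eval_nat (coeff_tensor ns s) ns)"
    using coeff_tensor_decomposition[of s] s(2) by blast
  \<comment> \<open>The sorted sum is itself invariant, so u - v is an invariant one level
    lower.\<close>
  define v where "v = (\<Sum>ns\<in>A. tensor_eval_nat (coeff_tensor (sort ns) s) (sort ns))"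
  have v: "v \<in> ?V"
    unfolding v_def by (intro cvec.span_sum cvec.span_base) (use inv sorted_sort in blast)
  have "v \<in> current_invariants"
    unfolding v_def by (intro cvec.subspace_sum[OF subspace_current_invariants] tensor_eval_nat_invariant inv)
  then have "u - v \<in> current_invariants"
    using Suc.prems(1) by (rule cvec.subspace_diff[OF subspace_current_invariants, rotated])
  moreover have "u - v \<in> envelope_filtration n"
    unfolding A(2) v_def sum_subtractf[symmetric]
    by (intro cvec.subspace_sum[OF subspace_envelope_filtration] sorting_exponents[OF s(1)])
  ultimately have "u - v \<in> ?V" by (rule Suc.IH)
  from cvec.span_add[OF this v] show ?case by simp
qed

lemma current_invariants_eq_span:
  assumes "reductive TYPE('g::complex_lie_algebra)"
  shows "current_invariants =
    cvec.span {tensor_eval_nat \<theta> ns | (\<theta> :: 'g tensor_algebra) ns. \<theta> \<in> tensor_invariants \<and> sorted ns}"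
proof (intro subset_antisym subsetI)
  fix u :: "'g poly enveloping_algebra" assume u: "u \<in> current_invariants"
  have "\<exists>n. u \<in> envelope_filtration n"
    using span_envelope_word[of u]
  proof (induction rule: cvec.span_induct_alt)
    case base
    show ?case by (auto simp: envelope_filtration_def cvec.span_zero)
  next
    case (step c x y)
    then obtain w n where x: "x = envelope_word w" and y: "y \<in> envelope_filtration n" by blast
    let ?m = "max (Suc (length w)) n"
    have "x \<in> envelope_filtration ?m" by (simp add: x envelope_word_in_filtration)
    moreover have "y \<in> envelope_filtration ?m"
      using y envelope_filtration_mono[of n ?m] by auto
    ultimately have "c *\<^sub>C x + y \<in> envelope_filtration ?m"
      by (intro cvec.subspace_add[OF subspace_envelope_filtration]
          cvec.subspace_scale[OF subspace_envelope_filtration])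
    then show ?case by blast
  qed
  with current_invariants_in_span[OF assms u]
  show "u \<in> cvec.span {tensor_eval_nat \<theta> ns | (\<theta> :: 'g tensor_algebra) ns. \<theta> \<in> tensor_invariants \<and> sorted ns}"
    by blast
next
  fix u assume "u \<in> cvec.span {tensor_eval_nat \<theta> ns | (\<theta> :: 'g tensor_algebra) ns. \<theta> \<in> tensor_invariants \<and> sorted ns}"
  then show "u \<in> current_invariants"
    using cvec.span_minimal[OF _ subspace_current_invariants,
        of "{tensor_eval_nat \<theta> ns | (\<theta> :: 'g tensor_algebra) ns. \<theta> \<in> tensor_invariants \<and> sorted ns}"]
      tensor_eval_nat_invariant by blast
qed

section \<open>Homogeneous bases and generators\<close>

lemma tensor_eval_nat_degree:
  "\<theta> \<in> tensor_power k \<Longrightarrow> k \<noteq> length ns \<Longrightarrow> tensor_eval_nat \<theta> ns = 0"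
  unfolding tensor_eval_nat_def by (rule tensor_eval_degree) simp_all

lemma complex_subalgebra_hull: "complex_subalgebra (complex_subalgebra hull S)"
proof (rule hull_in)
  fix T :: "'a set set" assume "Ball T complex_subalgebra"
  then show "complex_subalgebra (\<Inter>T)"
    by (auto simp: complex_subalgebra_def intro: cvec.subspace_Inter)
qed

lemma span_by_homogeneous_basis:
  fixes B :: "'g::complex_lie_algebra tensor_algebra set"
  assumes red: "reductive TYPE('g)"
    and span: "cvec.span B = tensor_invariants" and hom: "\<forall>\<theta>\<in>B. homogeneous \<theta>"
  shows "cvec.span {tensor_eval_nat \<theta> ns | \<theta> ns. \<theta> \<in> B \<and> \<theta> \<in> tensor_power (length ns) \<and> sorted ns} =
    current_invariants" (is "cvec.span ?E = _")
proof
  have "B \<subseteq> tensor_invariants" using span cvec.span_superset by blast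
  then have "?E \<subseteq> current_invariants"
    using tensor_eval_nat_invariant by blast
  then show "cvec.span ?E \<subseteq> current_invariants"
    by (rule cvec.span_minimal[OF _ subspace_current_invariants])
  have "tensor_eval_nat \<theta> ns \<in> cvec.span ?E" if "\<theta> \<in> cvec.span B" "sorted ns" for \<theta> ns
  proof (rule complex_linear_span[OF complex_linear_tensor_eval_nat that(1)])
    fix b assume b: "b \<in> B"
    then obtain k where k: "b \<in> tensor_power k" using hom by (auto simp: homogeneous_def)
    show "tensor_eval_nat b ns \<in> cvec.span ?E"
    \<comment> \<open>Evaluation at a list of the wrong length gives 0, so matching degree and
      length in \<open>?E\<close> loses nothing.\<close>
    proof (cases "k = length ns")
      case True
      then have "tensor_eval_nat b ns \<in> ?E" using b k that(2) by blast
      then show ?thesis by (rule cvec.span_base)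
    next
      case False
      then show ?thesis by (simp add: tensor_eval_nat_degree[OF k] cvec.span_zero)
    qed
  qed
  then show "current_invariants \<subseteq> cvec.span ?E"
    unfolding current_invariants_eq_span[OF red] span
    by (intro cvec.span_minimal) auto
qed

lemma generated_by_homogeneous_generators:
  fixes S :: "'g::complex_lie_algebra tensor_algebra set"
  assumes red: "reductive TYPE('g)"
    and gen: "complex_subalgebra hull S = tensor_invariants" and hom: "\<forall>\<theta>\<in>S. homogeneous \<theta>"
  shows "complex_subalgebra hull
      {tensor_eval_nat \<theta> ns | \<theta> ns. \<theta> \<in> S \<and> \<theta> \<in> tensor_power (length ns) \<and> sorted ns} =
    current_invariants" (is "complex_subalgebra hull ?E = _")
proof
  have "S \<subseteq> tensor_invariants" using hull_subset[of S complex_subalgebra] by (simp only: gen)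
  then have "?E \<subseteq> current_invariants"
    using tensor_eval_nat_invariant by blast
  then show "complex_subalgebra hull ?E \<subseteq> current_invariants"
    by (rule hull_minimal) (rule complex_subalgebra_current_invariants)
  let ?A = "complex_subalgebra hull ?E"
  have A: "cvec.subspace ?A" "1 \<in> ?A" "\<And>x y. x \<in> ?A \<Longrightarrow> y \<in> ?A \<Longrightarrow> x * y \<in> ?A"
    using complex_subalgebra_hull[of ?E] unfolding complex_subalgebra_def by blast+
  \<comment> \<open>This set is a subalgebra, because both pieces of a cut sorted list are sorted;
    as it contains \<open>S\<close>, it contains all invariant tensors.\<close>
  define R where "R = {\<theta> :: 'g tensor_algebra. \<forall>ns. sorted ns \<longrightarrow> tensor_eval_nat \<theta> ns \<in> ?A}"
  have "S \<subseteq> R"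
  proof
    fix b assume b: "b \<in> S"
    then obtain k where k: "b \<in> tensor_power k" using hom by (auto simp: homogeneous_def)
    have "tensor_eval_nat b ns \<in> ?A" if "sorted ns" for ns
    proof (cases "k = length ns")
      case True
      then have "tensor_eval_nat b ns \<in> ?E" using b k that by blast
      then show ?thesis by (rule hull_inc)
    next
      case False
      then show ?thesis by (simp add: tensor_eval_nat_degree[OF k] cvec.subspace_0[OF A(1)])
    qed
    then show "b \<in> R" by (simp add: R_def)
  qed
  moreover have "complex_subalgebra R"
    unfolding complex_subalgebra_def
  proof (intro conjI ballI)
    show "cvec.subspace R"
      by (rule cvec.subspaceI)
        (simp_all add: R_def complex_linear_zero[OF complex_linear_tensor_eval_nat]
          complex_linear_add[OF complex_linear_tensor_eval_nat]
          complex_linear_scaleC[OF complex_linear_tensor_eval_nat]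
          cvec.subspace_0[OF A(1)] cvec.subspace_add[OF A(1)] cvec.subspace_scale[OF A(1)])
    have "tensor_eval_nat (1 :: 'g tensor_algebra) ns = (if ns = [] then 1 else 0)" for ns
      by (simp add: tensor_eval_nat_def tensor_eval_simps(1))
    then show "1 \<in> R"
      by (simp add: R_def A(2) cvec.subspace_0[OF A(1)])
    fix a b assume ab: "a \<in> R" "b \<in> R"
    have "tensor_eval_nat (a * b) ns \<in> ?A" if "sorted ns" for ns
    proof -
      have "tensor_eval_nat (a * b) ns =
          (\<Sum>i\<le>length ns. tensor_eval_nat a (take i ns) * tensor_eval_nat b (drop i ns))"
        by (simp add: tensor_eval_nat_def tensor_eval_mult take_map drop_map)
      also have "\<dots> \<in> ?A"
        using ab that
        by (intro cvec.subspace_sum[OF A(1)] A(3)) (simp_all add: R_def sorted_wrt_take sorted_wrt_drop)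
      finally show ?thesis .
    qed
    then show "a * b \<in> R" by (simp add: R_def)
  qed
  ultimately have "complex_subalgebra hull S \<subseteq> R" by (rule hull_minimal)
  then show "current_invariants \<subseteq> ?A"
    unfolding current_invariants_eq_span[OF red] gen
    by (intro cvec.span_minimal A(1)) (auto simp: R_def)
qed

theorem proposition8:
  assumes "finite_dimensional TYPE('g::complex_lie_algebra)"
    and "reductive TYPE('g)"
  shows "(\<forall>B :: 'g tensor_algebra set.
      cvec.independent B \<and> cvec.span B = tensor_invariants \<and> (\<forall>\<theta>\<in>B. homogeneous \<theta>) \<longrightarrow>
      cvec.span {tensor_eval_nat \<theta> ns | \<theta> ns.
        \<theta> \<in> B \<and> \<theta> \<in> tensor_power (length ns) \<and> sorted ns} = current_invariants)
    \<and> (\<forall>S :: 'g tensor_algebra set.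
      complex_subalgebra hull S = tensor_invariants \<and> (\<forall>\<theta>\<in>S. homogeneous \<theta>) \<longrightarrow>
      complex_subalgebra hull {tensor_eval_nat \<theta> ns | \<theta> ns.
        \<theta> \<in> S \<and> \<theta> \<in> tensor_power (length ns) \<and> sorted ns} = current_invariants)"
  using span_by_homogeneous_basis[OF assms(2)] generated_by_homogeneous_generators[OF assms(2)]
  by blast

end
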